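(* Let $C:g=0$ be a reduced curve in $\mathbb{P}^2$ of degree $d-1$, with $g\in R=\mathbb{C}[x,y,z]$ and $\mathrm{mdr}(g)>0$. Consider the cone $X=cC: f=wg=0$ in $\mathbb{P}^3$, with $f\in S=\mathbb{C}[x,y,z,w]$. Let $r_j=(a_j,b_j,c_j)$, $j=1,\dots,m$, be a minimal set of homogeneous generators of the first syzygy $R$-module $D_0(g)$, and put $$\rho_0=(x,y,z,-(d-1)w),\qquad \rho_j=(a_j,b_j,c_j,0)\ \text{ for } j=1,\dots,m.$$ (1) The elements $\rho_0,\rho_1,\dots,\rho_m$ form a minimal set of generators of the first syzygy $S$-module $D_0(f)$. In particular, $\mathrm{mdr}(f)=1$. Moreover, if the minimal resolution of $D_0(g)$ is $$0\to\bigoplus_{j=1}^{q}R(-c_j)\to\bigoplus_{i=1}^{p}R(-d_i)\to D_0(g),$$ then the minimal resolution of $D_0(f)$ has the form $$0\to\bigoplus_{j=1}^{q}S(-c_j)\to S(-1)\oplus\Big(\bigoplus_{i=1}^{p}S(-d_i)\Big)\to D_0(f).$$ (2) The surface $X: f=wg=0$ is tame with respect to the pair $(\rho_0,\rho_1)$. (3) The surface $X$ is free (resp. nearly free, resp. strictly plus-one generated with respect to $\overline{\rho}_X=(\rho_0,\rho_1,\rho_2,\rho_3)$) if and only if the curve $C$ is free (resp. nearly free, resp. plus-one generated with respect to $\overline{\rho}_C=(\rho_1,\rho_2,\rho_3)$).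
   Context: For a homogeneous polynomial $h$ in a polynomial ring $T=\mathbb{C}[x_0,\dots,x_n]$, $D_0(h)$ is the graded $T$-module of derivations killing $h$, i.e. of tuples $(\alpha_0,\dots,\alpha_n)\in T^{n+1}$ with $\sum_i\alpha_i\,\partial h/\partial x_i=0$, graded by the degree of the coefficients $\alpha_i$. A tuple $(\alpha_0,\dots,\alpha_n)$ is identified with the derivation $\sum_i\alpha_i\partial_{x_i}$. $\mathrm{mdr}(h)$ is the minimal degree of a nonzero homogeneous element of $D_0(h)$. Minimal generators are listed in order of increasing degree. In the resolutions in (1), the degrees $c_j$ (integers) should not be confused with the third components $c_j$ of the generators $r_j$; also $p=m$. As usual here $d\ge 3$. In $\overline{\rho}_C$ the element $\rho_j$ is identified with $r_j=(a_j,b_j,c_j)\in D_0(g)$. Tameness: a surface $f=0$ in $\mathbb{P}^3$ is tame with respect to a pair $(\rho,\rho')$ of elements of $D_0(f)$ that are linearly independent over the fraction field of $S$ if every $\delta\in D_0(f)$ with $\delta\wedge\rho\wedge\rho'=0$ (i.e. lying in the span of $\rho,\rho'$ over the fraction field of $S$) belongs to $S\rho+S\rho'$. Let $V:h=0$ be a reduced hypersurface in $\mathbb{P}^n$ ($n=2$ or $3$), with $h\in T=\mathbb{C}[x_0,\dots,x_n]$. - $V$ is free if $D_0(h)$ is a free graded $T$-module (necessarily of rank $n$). - $V$ is plus-one generated with respect to $\overline{\delta}=(\delta_1,\dots,\delta_{n+1})$, where $\delta_i\in D_0(h)$ are homogeneous of degree $e_i$, if $\delta_1,\dots,\delta_{n+1}$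 is a minimal set of generators of $D_0(h)$ and the module of relations among them is free of rank one, generated by a relation of degree $e_{n+1}+1$, so that $D_0(h)$ has a minimal resolution $0\to T(-e_{n+1}-1)\to\bigoplus_{i=1}^{n+1}T(-e_i)\to D_0(h)\to 0$. It is strictly plus-one generated with respect to $\overline{\delta}$ if moreover the coefficient (a linear form) of $\delta_{n+1}$ in this relation is nonzero. - $V$ is nearly free if $D_0(h)$ has a minimal resolution $0\to T(-e_n-1)\to T(-e_1)\oplus\cdots\oplus T(-e_{n-1})\oplus T(-e_n)^2\to D_0(h)\to 0$ with $e_1\le\cdots\le e_n$. *)

theory Defs
  imports
    "HOL-Analysis.Analysis"
    "HOL-Computational_Algebra.Squarefree"
    "HOL-Computational_Algebra.Fraction_Field"
    "HOL-Library.Poly_Mapping"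
    "HOL-Library.Option_ord"
begin

text \<open>
  The ring \<open>\<complex>[x\<^sub>i | i \<in> 'v]\<close>: a finitely supported map from monomials (exponent vectors) to
  coefficients. For a finite index type \<open>'v\<close> it is the homogeneous coordinate ring of the
  projective space of dimension \<open>n = CARD('v) - 1\<close>; thus \<open>R = \<complex>[x,y,z]\<close> is \<open>3 mpol\<close> and
  \<open>S = R[w]\<close> is \<open>3 option mpol\<close>, with \<open>None\<close> indexing the new variable \<open>w\<close>.
\<close>

type_synonym 'v mpol = "('v \<Rightarrow>\<^sub>0 nat) \<Rightarrow>\<^sub>0 complex"

text \<open>The tuple \<open>\<alpha>\<close> stands for the derivation \<open>\<Sum>i. \<alpha> $ i \<partial>/\<partial>x\<^sub>i\<close>.\<close>

type_synonym 'v derivation = "('v mpol, 'v) vec"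

definition indet :: "'v \<Rightarrow> 'v mpol" where
  "indet i = Poly_Mapping.single (Poly_Mapping.single i 1) 1"

definition mono_degree :: "('v \<Rightarrow>\<^sub>0 nat) \<Rightarrow> nat" where
  "mono_degree t = (\<Sum>i\<in>Poly_Mapping.keys t. Poly_Mapping.lookup t i)"

text \<open>
  Degrees are integers, so that twists and differences of twists need no truncation. The zero
  polynomial is homogeneous of every degree, and the only one of negative degree.
\<close>

definition homogeneous :: "int \<Rightarrow> 'v mpol \<Rightarrow> bool" where
  "homogeneous k p \<longleftrightarrow> (\<forall>t\<in>Poly_Mapping.keys p. int (mono_degree t) = k)"

definition homogeneous_der :: "int \<Rightarrow> ('v::finite) derivation \<Rightarrow> bool" where
  "homogeneous_der k \<alpha> \<longleftrightarrow> (\<forall>i. homogeneous k (\<alpha> $ i))"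

text \<open>
  Monomials not involving \<open>x\<^sub>i\<close> contribute a zero coefficient, so the truncated subtraction of
  exponents is harmless.
\<close>

definition partial_deriv :: "'v \<Rightarrow> 'v mpol \<Rightarrow> 'v mpol" where
  "partial_deriv i p = (\<Sum>t\<in>Poly_Mapping.keys p.
     Poly_Mapping.single (t - Poly_Mapping.single i 1)
       (of_nat (Poly_Mapping.lookup t i) * Poly_Mapping.lookup p t))"

definition D0 :: "('v::finite) mpol \<Rightarrow> 'v derivation set" where
  "D0 h = {\<alpha>. (\<Sum>i\<in>UNIV. \<alpha> $ i * partial_deriv i h) = 0}"

definition mdr :: "('v::finite) mpol \<Rightarrow> nat" where
  "mdr h = (LEAST k. \<exists>\<alpha>\<in>D0 h. \<alpha> \<noteq> 0 \<and> homogeneous_der (int k) \<alpha>)"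

global_interpretation vmod: module "(*s) :: 'a::comm_ring_1 \<Rightarrow> 'a ^ 'n \<Rightarrow> 'a ^ 'n"
  by unfold_locales (simp_all add: vec_eq_iff algebra_simps)

text \<open>
  \<open>es\<close> is the list of degrees of the generators \<open>\<delta>s\<close>; generators are listed by increasing degree.
\<close>

definition minimal_generators ::
    "('v::finite) mpol \<Rightarrow> int list \<Rightarrow> 'v derivation list \<Rightarrow> bool" where
  "minimal_generators h es \<delta>s \<longleftrightarrow>
     length es = length \<delta>s \<and> sorted es \<and>
     (\<forall>i<length \<delta>s. \<delta>s ! i \<in> D0 h \<and> homogeneous_der (es ! i) (\<delta>s ! i)) \<and>
     vmod.span (set \<delta>s) = D0 h \<and>
     (\<forall>i<length \<delta>s. \<delta>s ! i \<notin> vmod.span {\<delta>s ! j | j. j < length \<delta>s \<and> j \<noteq> i})"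

text \<open>The free module \<open>T\<^sup>p\<close>, as sequences supported on \<open>{..<p}\<close>.\<close>

definition free_mod :: "nat \<Rightarrow> (nat \<Rightarrow> 'v mpol) set" where
  "free_mod p = {u. \<forall>i\<ge>p. u i = 0}"

definition relations :: "('v::finite) derivation list \<Rightarrow> (nat \<Rightarrow> 'v mpol) set" where
  "relations \<delta>s = {u \<in> free_mod (length \<delta>s). (\<Sum>i<length \<delta>s. u i *s \<delta>s ! i) = 0}"

text \<open>
  The map \<open>T\<^sup>q \<rightarrow> T\<^sup>p\<close> with matrix \<open>A\<close>; the entry \<open>A i j\<close> is in row \<open>i < p\<close> and column \<open>j < q\<close>.
\<close>

definition mat_map :: "nat \<Rightarrow> nat \<Rightarrow> (nat \<Rightarrow> nat \<Rightarrow> 'v mpol) \<Rightarrow> (nat \<Rightarrow> 'v mpol) \<Rightarrow> nat \<Rightarrow> 'v mpol" where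
  "mat_map p q A v = (\<lambda>i. if i < p then \<Sum>j<q. A i j * v j else 0)"

text \<open>
  \<open>D0 h\<close> has a minimal graded free resolution
  \<open>0 \<rightarrow> \<Oplus>\<^sub>j T(-c\<^sub>j) \<rightarrow> \<Oplus>\<^sub>i T(-d\<^sub>i) \<rightarrow> D0 h \<rightarrow> 0\<close>. The right-hand map sends the \<open>i\<close>-th basis vector to
  \<open>\<delta>s ! i\<close>, the left-hand one has matrix \<open>A\<close>; that they are graded of degree 0 means that
  \<open>\<delta>s ! i\<close> has degree \<open>d\<^sub>i\<close> and \<open>A i j\<close> has degree \<open>c\<^sub>j - d\<^sub>i\<close>. Minimality says that the entries
  of \<open>A\<close> lie in the maximal ideal generated by the variables, i.e. have no constant term.
\<close>

definition minimal_resolution :: "('v::finite) mpol \<Rightarrow> int list \<Rightarrow> int list \<Rightarrow> bool" where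
  "minimal_resolution h ds cs \<longleftrightarrow>
     (\<exists>\<delta>s A. let p = length ds; q = length cs in
        length \<delta>s = p \<and>
        (\<forall>i<p. \<delta>s ! i \<in> D0 h \<and> homogeneous_der (ds ! i) (\<delta>s ! i)) \<and>
        (\<forall>i<p. \<forall>j<q. homogeneous (cs ! j - ds ! i) (A i j)) \<and>
        vmod.span (set \<delta>s) = D0 h \<and>
        mat_map p q A ` free_mod q = relations \<delta>s \<and>
        inj_on (mat_map p q A) (free_mod q) \<and>
        (\<forall>i<p. \<forall>j<q. Poly_Mapping.lookup (A i j) 0 = 0))"

text \<open>A graded free module has a homogeneous basis.\<close>

definition free_hypersurface :: "('v::finite) mpol \<Rightarrow> bool" where
  "free_hypersurface h \<longleftrightarrow>
     (\<exists>B \<subseteq> D0 h. (\<forall>\<delta>\<in>B. \<exists>k. homogeneous_der k \<delta>) \<and> vmod.independent B \<and> vmod.span B = D0 h)"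

definition nearly_free :: "('v::finite) mpol \<Rightarrow> bool" where
  "nearly_free h \<longleftrightarrow>
     (\<exists>es. length es = CARD('v) - 1 \<and> sorted es \<and>
           minimal_resolution h (es @ [last es]) [last es + 1])"

text \<open>
  The \<open>n + 1 = CARD('v)\<close> derivations \<open>\<delta>s\<close>, of degrees \<open>es\<close>, minimally generate \<open>D0 h\<close>, and the
  relation \<open>u\<close>, homogeneous of degree \<open>e\<^sub>n\<^sub>+\<^sub>1 + 1\<close>, is a basis of their module of relations.
\<close>

definition plus_one_relation ::
    "('v::finite) mpol \<Rightarrow> int list \<Rightarrow> 'v derivation list \<Rightarrow> (nat \<Rightarrow> 'v mpol) \<Rightarrow> bool" where
  "plus_one_relation h es \<delta>s u \<longleftrightarrow>
     length \<delta>s = CARD('v) \<and> minimal_generators h es \<delta>s \<and>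
     (\<forall>i<length \<delta>s. homogeneous (last es + 1 - es ! i) (u i)) \<and>
     relations \<delta>s = {(\<lambda>i. a * u i) | a. True} \<and>
     (\<forall>a. (\<forall>i. a * u i = 0) \<longrightarrow> a = 0)"

definition plus_one_generated :: "('v::finite) mpol \<Rightarrow> 'v derivation list \<Rightarrow> bool" where
  "plus_one_generated h \<delta>s \<longleftrightarrow> (\<exists>es u. plus_one_relation h es \<delta>s u)"

definition strictly_plus_one_generated :: "('v::finite) mpol \<Rightarrow> 'v derivation list \<Rightarrow> bool" where
  "strictly_plus_one_generated h \<delta>s \<longleftrightarrow>
     (\<exists>es u. plus_one_relation h es \<delta>s u \<and> u (length \<delta>s - 1) \<noteq> 0)"

definition frac_independent :: "('v::{finite,linorder}) derivation \<Rightarrow> 'v derivation \<Rightarrow> bool" where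
  "frac_independent \<rho> \<rho>' \<longleftrightarrow>
     (\<forall>a b :: 'v mpol fract.
        (\<forall>i. a * Fract (\<rho> $ i) 1 + b * Fract (\<rho>' $ i) 1 = 0) \<longrightarrow> a = 0 \<and> b = 0)"

text \<open>\<open>\<delta> \<and> \<rho> \<and> \<rho>' = 0\<close>: the coordinates of the wedge product are the \<open>3 \<times> 3\<close> minors.\<close>

definition wedge_vanishes ::
    "('v::finite) derivation \<Rightarrow> 'v derivation \<Rightarrow> 'v derivation \<Rightarrow> bool" where
  "wedge_vanishes \<delta> \<rho> \<rho>' \<longleftrightarrow>
     (\<forall>i j k. det (vector [vector [\<delta> $ i, \<delta> $ j, \<delta> $ k],
                           vector [\<rho> $ i, \<rho> $ j, \<rho> $ k],
                           vector [\<rho>' $ i, \<rho>' $ j, \<rho>' $ k]] :: 'v mpol ^ 3 ^ 3) = 0)"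

definition tame :: "('v::{finite,linorder}) mpol \<Rightarrow> 'v derivation \<Rightarrow> 'v derivation \<Rightarrow> bool" where
  "tame f \<rho> \<rho>' \<longleftrightarrow>
     \<rho> \<in> D0 f \<and> \<rho>' \<in> D0 f \<and> frac_independent \<rho> \<rho>' \<and>
     (\<forall>\<delta>\<in>D0 f. wedge_vanishes \<delta> \<rho> \<rho>' \<longrightarrow> (\<exists>a b. \<delta> = a *s \<rho> + b *s \<rho>'))"

text \<open>The inclusion \<open>R \<rightarrow> R[w]\<close>.\<close>

definition incl :: "('v::finite) mpol \<Rightarrow> 'v option mpol" where
  "incl p = (\<Sum>t\<in>Poly_Mapping.keys p.
     Poly_Mapping.single 0 (Poly_Mapping.lookup p t) *
     (\<Prod>i\<in>UNIV. indet (Some i) ^ Poly_Mapping.lookup t i))"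

definition cone_poly :: "('v::finite) mpol \<Rightarrow> 'v option mpol" where
  "cone_poly g = indet None * incl g"

text \<open>\<open>(a, b, c) \<mapsto> (a, b, c, 0)\<close>\<close>

definition lift_der :: "('v::finite) derivation \<Rightarrow> 'v option derivation" where
  "lift_der r = (\<chi> i. case i of Some k \<Rightarrow> incl (r $ k) | None \<Rightarrow> 0)"

text \<open>\<open>\<rho>\<^sub>0 = (x, y, z, -(d - 1) w)\<close>\<close>

definition rho0 :: "nat \<Rightarrow> ('v::finite) option derivation" where
  "rho0 d = (\<chi> i. case i of Some k \<Rightarrow> indet (Some k) | None \<Rightarrow> - (of_nat (d - 1) * indet None))"

text \<open>The list \<open>\<rho>\<^sub>0, \<rho>\<^sub>1, \<dots>, \<rho>\<^sub>m\<close> obtained from \<open>r\<^sub>1, \<dots>, r\<^sub>m\<close>.\<close>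

definition rhos :: "nat \<Rightarrow> ('v::finite) derivation list \<Rightarrow> 'v option derivation list" where
  "rhos d rs = rho0 d # map lift_der rs"

end

theory Submission
  imports Defs "HOL-Computational_Algebra.Polynomial_Factorial" "HOL-Computational_Algebra.Field_as_Ring"
begin

text \<open>
  Write \<open>f = w g\<close>. If \<open>\<delta>\<close> kills \<open>f\<close>, then \<open>w\<close> divides its last component, and by Euler's formula
  subtracting a multiple of \<open>\<rho>\<^sub>0\<close> makes that component vanish; what remains is a combination of powers
  of \<open>w\<close> with coefficients in \<open>D\<^sub>0(g)\<close>. Hence \<open>D\<^sub>0(f) = S \<rho>\<^sub>0 \<oplus> D\<^sub>0(g)[w]\<close>, and the relations among the
  \<open>\<rho>\<^sub>j\<close> are those among the \<open>r\<^sub>j\<close>, extended from \<open>R\<close> to \<open>S = R[w]\<close>. To return from \<open>f\<close> to \<open>g\<close> one sets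
  \<open>w = 0\<close>, after replacing an arbitrary minimal generating system of \<open>D\<^sub>0(f)\<close> by the \<open>\<rho>\<^sub>j\<close>: minimal
  systems have the same degrees, and a generator of the relations of one yields a generator for the
  other. Tameness, and the nonvanishing of the last coefficient of the relation in the plus-one
  generated case, hold because \<open>r\<^sub>1\<close> has minimal degree and so, \<open>R\<close> being factorial, every syzygy
  parallel to \<open>r\<^sub>1\<close> is a multiple of it.
\<close>

section \<open>Ring homomorphisms and polynomial substitution\<close>

text \<open>Minimality is used in the form that no relation among the generators has a coefficient
  with nonzero constant term. Unlike irredundance, this can be read off from the coefficients of
  \<open>w^0\<close>, so it passes from R to R[w] at once. It also makes two minimal systems
  comparable: the transition matrices between them need not be inverse to each other, but they are
  so modulo the maximal ideal. The hypothesis mdr(g) > 0 gives every r_j degree at least 1, so that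
  rho_0 can head the list sorted by degree. The number d - 1 is a nonzero complex constant, so the
  last coordinate of rho_0 is a unit times w; this coordinate separates rho_0 from all derivations
  lifted from R. Factoriality of R comes from an isomorphism with an iterated univariate polynomial
  ring.\<close>

locale cring_hom =
  fixes \<phi> :: "'a::comm_ring_1 \<Rightarrow> 'b::comm_ring_1"
  assumes hom_add: "\<phi> (a + b) = \<phi> a + \<phi> b"
    and hom_mult: "\<phi> (a * b) = \<phi> a * \<phi> b"
    and hom_one: "\<phi> 1 = 1"
begin

lemma hom_zero: "\<phi> 0 = 0"
  using hom_add[of 0 0] by simp

lemma hom_uminus: "\<phi> (- a) = - \<phi> a"
  using hom_add[of a "- a"] by (simp add: hom_zero eq_neg_iff_add_eq_0 add.commute)

lemma hom_diff: "\<phi> (a - b) = \<phi> a - \<phi> b"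
  using hom_add[of a "- b"] by (simp add: hom_uminus)

lemma hom_sum: "\<phi> (sum f A) = (\<Sum>a\<in>A. \<phi> (f a))"
  by (induction A rule: infinite_finite_induct) (simp_all add: hom_zero hom_add)

lemma hom_prod: "\<phi> (prod f A) = (\<Prod>a\<in>A. \<phi> (f a))"
  by (induction A rule: infinite_finite_induct) (simp_all add: hom_one hom_mult)

lemma hom_power: "\<phi> (a ^ n) = \<phi> a ^ n"
  by (induction n) (simp_all add: hom_one hom_mult)

lemma hom_of_nat: "\<phi> (of_nat n) = of_nat n"
  by (induction n) (simp_all add: hom_zero hom_one hom_add)

end

lemma cring_hom_comp:
  assumes "cring_hom \<phi>" "cring_hom \<psi>"
  shows "cring_hom (\<lambda>a. \<phi> (\<psi> a))"
proof -
  interpret f: cring_hom \<phi> by fact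
  interpret g: cring_hom \<psi> by fact
  show ?thesis
    by unfold_locales (simp_all add: f.hom_add g.hom_add f.hom_mult g.hom_mult f.hom_one g.hom_one)
qed

lemma cring_hom_id: "cring_hom (\<lambda>a. a)"
  by unfold_locales simp_all

lemma cring_hom_const_poly: "cring_hom (\<lambda>a. [:a:])"
  by unfold_locales simp_all

lemma cring_hom_coeff_0: "cring_hom (\<lambda>p :: 'a::comm_ring_1 poly. poly.coeff p 0)"
  by unfold_locales (simp_all add: coeff_mult_0)

lemma cring_hom_const_mpol: "cring_hom (\<lambda>a. Poly_Mapping.single (0 :: 'v \<Rightarrow>\<^sub>0 nat) (a :: complex))"
  by unfold_locales (simp_all add: single_add mult_single)

lemma poly_map_poly_pCons:
  "cring_hom \<phi> \<Longrightarrow> poly (map_poly \<phi> (pCons a p)) b = \<phi> a + b * poly (map_poly \<phi> p) b"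
  by (cases "a = 0 \<and> p = 0") (auto simp: map_poly_pCons cring_hom.hom_zero)

lemma poly_map_poly_const:
  "cring_hom \<phi> \<Longrightarrow> poly (map_poly \<phi> [:a:]) b = \<phi> a"
  by (simp add: poly_map_poly_pCons)

lemma poly_map_poly_X:
  "cring_hom \<phi> \<Longrightarrow> poly (map_poly \<phi> [:0, 1:]) b = b"
  by (simp add: poly_map_poly_pCons cring_hom.hom_zero cring_hom.hom_one)

lemma cring_hom_poly_eval:
  fixes \<phi> :: "'a::comm_ring_1 \<Rightarrow> 'b::comm_ring_1"
  assumes "cring_hom \<phi>"
  shows "cring_hom (\<lambda>p. poly (map_poly \<phi> p) b)"
proof -
  interpret cring_hom \<phi> by fact
  note cons = poly_map_poly_pCons[OF assms]
  have add: "poly (map_poly \<phi> (p + q)) b = poly (map_poly \<phi> p) b + poly (map_poly \<phi> q) b" for p q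
    by (induction p q rule: poly_induct2) (simp_all add: cons hom_add algebra_simps)
  have smult: "poly (map_poly \<phi> (smult a p)) b = \<phi> a * poly (map_poly \<phi> p) b" for a p
    by (induction p) (simp_all add: cons hom_mult algebra_simps)
  have "poly (map_poly \<phi> (p * q)) b = poly (map_poly \<phi> p) b * poly (map_poly \<phi> q) b" for p q
    by (induction p) (simp_all add: cons add smult hom_zero algebra_simps)
  then show ?thesis
    by unfold_locales (simp_all add: add hom_one map_poly_1)
qed

lemma cring_hom_poly_ext:
  fixes \<phi> \<psi> :: "'a::comm_ring_1 poly \<Rightarrow> 'b::comm_ring_1"
  assumes "cring_hom \<phi>" "cring_hom \<psi>"
    and "\<And>a. \<phi> [:a:] = \<psi> [:a:]" and "\<phi> [:0, 1:] = \<psi> [:0, 1:]"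
  shows "\<phi> p = \<psi> p"
proof -
  interpret f: cring_hom \<phi> by fact
  interpret g: cring_hom \<psi> by fact
  show ?thesis
  proof (induction p)
    case (pCons a p)
    have "pCons a p = [:a:] + [:0, 1:] * p"
      by simp
    then show ?case
      by (simp only: f.hom_add g.hom_add f.hom_mult g.hom_mult assms pCons)
  qed (simp add: f.hom_zero g.hom_zero)
qed

text \<open>Additive maps and conditions then need checking on single terms only. The supports of
  \<open>p\<close> and \<open>q\<close> may overlap, which spares any bookkeeping of keys.\<close>

lemma poly_mapping_single_add_induct [case_names single add]:
  assumes single: "\<And>k v. P (Poly_Mapping.single k v)"
    and add: "\<And>p q. P p \<Longrightarrow> P q \<Longrightarrow> P (p + q)"
  shows "P (p :: 'a \<Rightarrow>\<^sub>0 'b::monoid_add)"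
proof (induction p rule: update_induct)
  case const
  show ?case using single[of undefined 0] by simp
next
  case (update p a b)
  have "Poly_Mapping.update a b p = Poly_Mapping.single a b + p"
    using update.hyps
    by (intro poly_mapping_eqI) (auto simp: lookup_update lookup_add lookup_single in_keys_iff when_def)
  then show ?case using update.IH add single by simp
qed

text \<open>The evaluation map of the universal property, with \<open>c\<close> on coefficients and
  \<open>X\<close> on variables. Having \<open>incl\<close>, \<open>wpoly\<close> and
  \<open>tpoly\<close> as instances lets composites be compared on generators.\<close>

definition msubst ::
    "(complex \<Rightarrow> 'b::comm_ring_1) \<Rightarrow> ('v::finite \<Rightarrow> 'b) \<Rightarrow> 'v mpol \<Rightarrow> 'b" where
  "msubst c X p = (\<Sum>t\<in>Poly_Mapping.keys p.
     c (Poly_Mapping.lookup p t) * (\<Prod>i\<in>UNIV. X i ^ Poly_Mapping.lookup t i))"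

context
  fixes c :: "complex \<Rightarrow> 'b::comm_ring_1" and X :: "'v::finite \<Rightarrow> 'b"
  assumes c: "cring_hom c"
begin

interpretation c: cring_hom c by (rule c)

lemma msubst_add: "msubst c X (p + q) = msubst c X p + msubst c X q"
  unfolding msubst_def
  by (rule setsum_keys_plus_distrib) (simp_all add: c.hom_zero c.hom_add distrib_right)

lemma msubst_single:
  "msubst c X (Poly_Mapping.single t a) = c a * (\<Prod>i\<in>UNIV. X i ^ Poly_Mapping.lookup t i)"
  by (cases "a = 0") (simp_all add: msubst_def c.hom_zero)

lemma msubst_mult: "msubst c X (p * q) = msubst c X p * msubst c X q"
proof (induction p rule: poly_mapping_single_add_induct)
  case (single s a)
  show ?case
    by (induction q rule: poly_mapping_single_add_induct)
      (simp_all add: mult_single msubst_single c.hom_mult lookup_add power_add prod.distrib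
        distrib_left msubst_add)
qed (simp_all add: distrib_right msubst_add)

lemma cring_hom_msubst: "cring_hom (msubst c X)"
  by unfold_locales
    (simp_all add: msubst_add msubst_mult msubst_single c.hom_one flip: single_one)

lemma msubst_const: "msubst c X (Poly_Mapping.single 0 a) = c a"
  by (simp add: msubst_single)

lemma msubst_indet: "msubst c X (indet i) = X i"
proof -
  have "(\<Prod>j\<in>UNIV. X j ^ Poly_Mapping.lookup (Poly_Mapping.single i (1::nat)) j) = (\<Prod>j\<in>{i}. X j)"
    by (rule prod.mono_neutral_cong_right) (auto simp: lookup_single when_def)
  then show ?thesis
    by (simp add: indet_def msubst_single c.hom_one)
qed

end

lemma indet_power: "indet i ^ n = Poly_Mapping.single (Poly_Mapping.single i n) 1"
  by (induction n) (simp_all add: indet_def mult_single flip: single_add)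

lemma prod_single_one:
  "finite A \<Longrightarrow>
    (\<Prod>i\<in>A. Poly_Mapping.single (f i) (1 :: complex)) = Poly_Mapping.single (\<Sum>i\<in>A. f i) 1"
  by (induction A rule: finite_induct) (simp_all add: mult_single)

lemma sum_single_lookup:
  fixes t :: "'v::finite \<Rightarrow>\<^sub>0 nat"
  shows "(\<Sum>i\<in>UNIV. Poly_Mapping.single i (Poly_Mapping.lookup t i)) = t"
  by (rule poly_mapping_eqI) (simp add: lookup_sum lookup_single when_def)

lemma single_eq_prod_indet:
  fixes t :: "'v::finite \<Rightarrow>\<^sub>0 nat"
  shows "Poly_Mapping.single t a
    = Poly_Mapping.single 0 a * (\<Prod>i\<in>UNIV. indet i ^ Poly_Mapping.lookup t i)"
  by (simp add: indet_power prod_single_one sum_single_lookup mult_single)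

lemma cring_hom_mpol_ext:
  fixes \<phi> \<psi> :: "'v::finite mpol \<Rightarrow> 'b::comm_ring_1"
  assumes "cring_hom \<phi>" "cring_hom \<psi>"
    and "\<And>a. \<phi> (Poly_Mapping.single 0 a) = \<psi> (Poly_Mapping.single 0 a)"
    and "\<And>i. \<phi> (indet i) = \<psi> (indet i)"
  shows "\<phi> p = \<psi> p"
proof -
  interpret f: cring_hom \<phi> by fact
  interpret g: cring_hom \<psi> by fact
  show ?thesis
  proof (induction p rule: poly_mapping_single_add_induct)
    case (single t a)
    show ?case
      by (subst (1 2) single_eq_prod_indet)
        (simp add: f.hom_mult g.hom_mult f.hom_prod g.hom_prod f.hom_power g.hom_power assms)
  qed (simp add: f.hom_add g.hom_add)
qed

section \<open>Homogeneous components, constant terms and partial derivatives\<close>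

lemma mono_degree_eq_sum: "mono_degree (t :: 'v::finite \<Rightarrow>\<^sub>0 nat) = (\<Sum>i\<in>UNIV. Poly_Mapping.lookup t i)"
  unfolding mono_degree_def by (rule sum.mono_neutral_left) (auto simp: in_keys_iff)

lemma mono_degree_add:
  "mono_degree (s + t :: 'v::finite \<Rightarrow>\<^sub>0 nat) = mono_degree s + mono_degree t"
  by (simp add: mono_degree_eq_sum lookup_add sum.distrib)

lemma mono_degree_single: "mono_degree (Poly_Mapping.single i n) = n"
  by (cases "n = 0") (simp_all add: mono_degree_def)

lemma mono_degree_eq_0_iff: "mono_degree (t :: 'v::finite \<Rightarrow>\<^sub>0 nat) = 0 \<longleftrightarrow> t = 0"
  by (auto simp: mono_degree_eq_sum intro!: poly_mapping_eqI)

lemma homogeneous_zero: "homogeneous k 0"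
  by (simp add: homogeneous_def)

lemma homogeneous_add: "homogeneous k p \<Longrightarrow> homogeneous k q \<Longrightarrow> homogeneous k (p + q)"
  using keys_add[of p q] by (auto simp: homogeneous_def)

lemma homogeneous_uminus: "homogeneous k p \<Longrightarrow> homogeneous k (- p)"
  by (simp add: homogeneous_def in_keys_iff)

lemma homogeneous_diff: "homogeneous k p \<Longrightarrow> homogeneous k q \<Longrightarrow> homogeneous k (p - q)"
  using homogeneous_add[of k p "- q"] by (simp add: homogeneous_uminus)

lemma homogeneous_sum: "(\<And>i. i \<in> A \<Longrightarrow> homogeneous k (f i)) \<Longrightarrow> homogeneous k (sum f A)"
  by (induction A rule: infinite_finite_induct) (simp_all add: homogeneous_zero homogeneous_add)

lemma homogeneous_mult:
  assumes "homogeneous k (p :: 'v::finite mpol)" "homogeneous l q"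
  shows "homogeneous (k + l) (p * q)"
  using assms keys_mult[of p q] by (fastforce simp: homogeneous_def mono_degree_add)

lemma homogeneous_single: "homogeneous k (Poly_Mapping.single t a) \<longleftrightarrow> a = 0 \<or> int (mono_degree t) = k"
  by (simp add: homogeneous_def)

lemma homogeneous_indet: "homogeneous 1 (indet i)"
  by (simp add: indet_def homogeneous_single mono_degree_single)

lemma homogeneous_of_nat: "homogeneous 0 (of_nat n :: 'v::finite mpol)"
  by (simp add: homogeneous_single mono_degree_eq_0_iff flip: single_of_nat)

lemma homogeneous_one: "homogeneous 0 (1 :: 'v::finite mpol)"
  using homogeneous_of_nat[of 1] by simp

lemma homogeneous_power: "homogeneous 1 (p :: 'v::finite mpol) \<Longrightarrow> homogeneous (int n) (p ^ n)"
  by (induction n) (simp_all add: homogeneous_one homogeneous_mult)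

lemma homogeneous_prod:
  "(\<And>i. i \<in> A \<Longrightarrow> homogeneous (n i) (f i :: 'v::finite mpol)) \<Longrightarrow> homogeneous (sum n A) (prod f A)"
  by (induction A rule: infinite_finite_induct) (simp_all add: homogeneous_one homogeneous_mult)

lemma homogeneous_const: "homogeneous 0 (Poly_Mapping.single (0 :: 'v::finite \<Rightarrow>\<^sub>0 nat) a)"
  by (simp add: homogeneous_single mono_degree_eq_0_iff)

lemma homogeneous_neg_eq_0: "homogeneous k p \<Longrightarrow> k < 0 \<Longrightarrow> p = 0"
  by (rule ccontr) (auto simp: homogeneous_def poly_mapping_eq_iff fun_eq_iff in_keys_iff)

definition hcomp :: "int \<Rightarrow> 'v mpol \<Rightarrow> 'v mpol" where
  "hcomp k p = Poly_Mapping.mapp (\<lambda>t a. if int (mono_degree t) = k then a else 0) p"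

lemma lookup_hcomp:
  "Poly_Mapping.lookup (hcomp k p) t
    = (if int (mono_degree t) = k then Poly_Mapping.lookup p t else 0)"
  by (simp add: hcomp_def lookup_mapp when_def in_keys_iff)

lemma hcomp_zero: "hcomp k 0 = 0"
  by (rule poly_mapping_eqI) (simp add: lookup_hcomp)

lemma hcomp_add: "hcomp k (p + q) = hcomp k p + hcomp k q"
  by (rule poly_mapping_eqI) (simp add: lookup_hcomp lookup_add)

lemma hcomp_sum: "hcomp k (sum f A) = (\<Sum>i\<in>A. hcomp k (f i))"
  by (induction A rule: infinite_finite_induct) (simp_all add: hcomp_zero hcomp_add)

lemma hcomp_single:
  "hcomp k (Poly_Mapping.single t a) = (if int (mono_degree t) = k then Poly_Mapping.single t a else 0)"
  by (rule poly_mapping_eqI) (auto simp: lookup_hcomp lookup_single when_def)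

lemma homogeneous_hcomp: "homogeneous k (hcomp k p)"
  by (auto simp: homogeneous_def in_keys_iff lookup_hcomp split: if_splits)

lemma homogeneous_iff_hcomp: "homogeneous k p \<longleftrightarrow> hcomp k p = p"
proof
  assume "homogeneous k p"
  then show "hcomp k p = p"
    by (intro poly_mapping_eqI) (auto simp: lookup_hcomp homogeneous_def in_keys_iff)
qed (metis homogeneous_hcomp)

lemma hcomp_homogeneous: "homogeneous l p \<Longrightarrow> hcomp k p = (if k = l then p else 0)"
  by (intro poly_mapping_eqI) (auto simp: lookup_hcomp homogeneous_def in_keys_iff)

lemma hcomp_mult_homogeneous:
  fixes p q :: "'v::finite mpol"
  assumes "homogeneous e q"
  shows "hcomp k (p * q) = hcomp (k - e) p * q"
proof (induction p rule: poly_mapping_single_add_induct)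
  case (single t a)
  have "homogeneous (int (mono_degree t) + e) (Poly_Mapping.single t a * q)"
    by (intro homogeneous_mult assms) (simp add: homogeneous_single)
  then show ?case
    by (auto simp: hcomp_homogeneous hcomp_single)
qed (simp_all add: distrib_right hcomp_add)

text \<open>The entries of one relation carry different degree shifts \<open>e\<close>. Any finite
  \<open>K\<close> containing the shifted degrees recovers an entry, so one \<open>K\<close> can
  serve all of them.\<close>

lemma sum_hcomp_shifted:
  assumes "finite K" "\<And>t. t \<in> Poly_Mapping.keys p \<Longrightarrow> int (mono_degree t) + e \<in> K"
  shows "(\<Sum>k\<in>K. hcomp (k - e) p) = p"
proof (rule poly_mapping_eqI)
  fix t
  have "(\<Sum>k\<in>K. Poly_Mapping.lookup (hcomp (k - e) p) t)
      = (\<Sum>k\<in>K. if int (mono_degree t) + e = k then Poly_Mapping.lookup p t else 0)"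
    by (rule sum.cong) (auto simp: lookup_hcomp)
  also have "\<dots> = Poly_Mapping.lookup p t"
    using assms by (auto simp: in_keys_iff)
  finally show "Poly_Mapping.lookup (\<Sum>k\<in>K. hcomp (k - e) p) t = Poly_Mapping.lookup p t"
    by (simp add: lookup_sum)
qed

abbreviation const_term :: "'v mpol \<Rightarrow> complex" where
  "const_term p \<equiv> Poly_Mapping.lookup p 0"

lemma cring_hom_const_term: "cring_hom (const_term :: 'v mpol \<Rightarrow> complex)"
proof
  fix p q :: "'v mpol"
  show "const_term (p * q) = const_term p * const_term q"
  proof (induction p rule: poly_mapping_single_add_induct)
    case (single s a)
    \<comment> \<open>Exponents are natural numbers and cannot cancel, so only the two constant
      terms contribute to the constant term of a product.\<close>
    have add_eq_0: "s + t = 0 \<longleftrightarrow> s = 0 \<and> t = 0" for t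
      by (auto simp: poly_mapping_eq_iff fun_eq_iff lookup_add)
    show ?case
      by (induction q rule: poly_mapping_single_add_induct)
        (auto simp: mult_single lookup_single when_def add_eq_0 distrib_left lookup_add)
  qed (simp_all add: distrib_right lookup_add)
qed (simp_all add: lookup_add)

interpretation const_term: cring_hom "const_term :: 'v mpol \<Rightarrow> complex"
  by (rule cring_hom_const_term)

lemma homogeneous_0_iff: "homogeneous 0 (p :: 'v::finite mpol) \<longleftrightarrow> p = Poly_Mapping.single 0 (const_term p)"
proof
  assume "homogeneous 0 p"
  then show "p = Poly_Mapping.single 0 (const_term p)"
    by (intro poly_mapping_eqI)
      (auto simp: lookup_single when_def homogeneous_def in_keys_iff mono_degree_eq_0_iff)
qed (metis homogeneous_const)

lemma const_term_homogeneous: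
  "homogeneous k (p :: 'v::finite mpol) \<Longrightarrow> k \<noteq> 0 \<Longrightarrow> const_term p = 0"
  by (rule ccontr) (auto simp: homogeneous_def in_keys_iff mono_degree_eq_0_iff dest!: bspec[where x = 0])

lemma const_term_hcomp_0: "const_term (hcomp 0 (p :: 'v::finite mpol)) = const_term p"
  by (simp add: lookup_hcomp mono_degree_def)

section \<open>Partial derivatives and Euler's formula\<close>

lemma partial_deriv_add: "partial_deriv i (p + q) = partial_deriv i p + partial_deriv i q"
  unfolding partial_deriv_def
  by (rule setsum_keys_plus_distrib) (simp_all add: distrib_left single_add)

lemma partial_deriv_single:
  "partial_deriv i (Poly_Mapping.single t a)
    = Poly_Mapping.single (t - Poly_Mapping.single i 1) (of_nat (Poly_Mapping.lookup t i) * a)"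
  by (cases "a = 0") (simp_all add: partial_deriv_def)

lemma partial_deriv_zero: "partial_deriv i 0 = 0"
  by (simp add: partial_deriv_def)

lemma diff_single_add:
  "Poly_Mapping.lookup t i \<noteq> 0 \<Longrightarrow> (t :: 'v \<Rightarrow>\<^sub>0 nat) - Poly_Mapping.single i 1 + Poly_Mapping.single i 1 = t"
  by (rule poly_mapping_eqI) (auto simp: lookup_add lookup_minus lookup_single when_def)

lemma indet_mult_partial_deriv_single:
  "indet i * partial_deriv i (Poly_Mapping.single t a)
    = Poly_Mapping.single t (of_nat (Poly_Mapping.lookup t i) * a)"
  by (cases "Poly_Mapping.lookup t i = 0")
    (simp_all add: partial_deriv_single indet_def mult_single diff_single_add[simplified]
      add.commute[of "Poly_Mapping.single _ _"])

lemma euler_formula: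
  fixes p :: "'v::finite mpol"
  assumes "homogeneous (int n) p"
  shows "(\<Sum>i\<in>UNIV. indet i * partial_deriv i p) = of_nat n * p"
proof -
  \<comment> \<open>Homogeneity of \<open>p\<close> is not inherited by an induction over terms. The
    component \<open>hcomp (int n) q\<close> of an arbitrary \<open>q\<close> is additive in
    \<open>q\<close>, and it equals \<open>p\<close> for \<open>q = p\<close>.\<close>
  have *: "(\<Sum>i\<in>UNIV. indet i * partial_deriv i (hcomp (int n) q)) = of_nat n * hcomp (int n) q"
    for q :: "'v mpol"
  proof (induction q rule: poly_mapping_single_add_induct)
    case (single t a)
    show ?case
    proof (cases "mono_degree t = n")
      case True
      have "(\<Sum>i\<in>UNIV. indet i * partial_deriv i (Poly_Mapping.single t a))
          = (\<Sum>i\<in>UNIV. Poly_Mapping.single t (of_nat (Poly_Mapping.lookup t i) * a))"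
        by (simp add: indet_mult_partial_deriv_single)
      also have "\<dots> = Poly_Mapping.single t (of_nat (mono_degree t) * a)"
        by (rule poly_mapping_eqI)
          (simp add: lookup_sum lookup_single when_def mono_degree_eq_sum sum_distrib_right)
      also have "\<dots> = of_nat n * Poly_Mapping.single t a"
        using True by (simp add: mult_single flip: single_of_nat)
      finally show ?thesis
        using True by (simp add: hcomp_single)
    qed (simp add: hcomp_single partial_deriv_zero)
  qed (simp add: hcomp_add partial_deriv_add distrib_left sum.distrib)
  show ?thesis
    using *[of p] assms by (simp add: homogeneous_iff_hcomp)
qed

lemma homogeneous_partial_deriv:
  fixes p :: "'v::finite mpol"
  assumes "homogeneous k p"
  shows "homogeneous (k - 1) (partial_deriv i p)"
proof -
  have "homogeneous (k - 1) (partial_deriv i (hcomp k q))" for q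
  proof (induction q rule: poly_mapping_single_add_induct)
    case (single t a)
    show ?case
    proof (cases "Poly_Mapping.lookup t i = 0")
      case False
      then have "mono_degree t = mono_degree (t - Poly_Mapping.single i 1) + 1"
        by (metis diff_single_add mono_degree_add mono_degree_single)
      then show ?thesis
        by (simp add: hcomp_single partial_deriv_single homogeneous_single partial_deriv_zero homogeneous_zero)
    qed (simp add: hcomp_single partial_deriv_single partial_deriv_zero homogeneous_zero)
  qed (simp add: hcomp_add partial_deriv_add homogeneous_add)
  then show ?thesis
    using assms by (metis homogeneous_iff_hcomp)
qed

section \<open>Minimal generators and their relations\<close>

text \<open>Coefficients are attached to indices rather than to vectors, so repeated generators do
  no harm and the format agrees with \<open>relations\<close>.\<close>

lemma span_image_iff:
  fixes f :: "'i \<Rightarrow> 'a::comm_ring_1 ^ 'n"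
  assumes "finite J"
  shows "x \<in> vmod.span (f ` J) \<longleftrightarrow> (\<exists>u. x = (\<Sum>j\<in>J. u j *s f j))"
proof
  show "x \<in> vmod.span (f ` J) \<Longrightarrow> \<exists>u. x = (\<Sum>j\<in>J. u j *s f j)"
    using assms
  proof (induction J arbitrary: x rule: finite_induct)
    case (insert j J)
    then obtain k where "x - k *s f j \<in> vmod.span (f ` J)"
      by (auto simp: vmod.span_insert)
    then obtain u where u: "x - k *s f j = (\<Sum>i\<in>J. u i *s f i)"
      using insert.IH by blast
    have "(\<Sum>i\<in>J. (u(j := k)) i *s f i) = (\<Sum>i\<in>J. u i *s f i)"
      using insert.hyps by (intro sum.cong) auto
    then have "x = (\<Sum>i\<in>insert j J. (u(j := k)) i *s f i)"
      using insert.hyps u by (simp add: algebra_simps)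
    then show ?case by blast
  qed simp
  show "\<exists>u. x = (\<Sum>j\<in>J. u j *s f j) \<Longrightarrow> x \<in> vmod.span (f ` J)"
    by (auto intro!: vmod.span_sum vmod.span_scale intro: vmod.span_base)
qed

lemma set_eq_image_nth: "set xs = (!) xs ` {..<length xs}"
  by (auto simp: set_conv_nth)

lemma span_set_iff:
  "x \<in> vmod.span (set \<delta>s) \<longleftrightarrow> (\<exists>u. x = (\<Sum>i<length \<delta>s. u i *s \<delta>s ! i))"
  unfolding set_eq_image_nth by (rule span_image_iff) simp

section \<open>Minimality expressed by relations\<close>

definition graded_list :: "int list \<Rightarrow> ('v::finite) derivation list \<Rightarrow> bool" where
  "graded_list es \<delta>s \<longleftrightarrow>
     length es = length \<delta>s \<and> (\<forall>i<length \<delta>s. homogeneous_der (es ! i) (\<delta>s ! i))"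

text \<open>The graded Nakayama form of minimality. For homogeneous generators it is equivalent to
  irredundance, by \<open>minimal_relationsI\<close> and
  \<open>minimal_relations_irredundant\<close>.\<close>

definition minimal_relations :: "('v::finite) derivation list \<Rightarrow> bool" where
  "minimal_relations \<delta>s \<longleftrightarrow> (\<forall>u\<in>relations \<delta>s. \<forall>i. const_term (u i) = 0)"

lemma relations_smult: "u \<in> relations \<delta>s \<Longrightarrow> (\<lambda>i. a * u i) \<in> relations \<delta>s"
proof -
  have "(\<Sum>i<length \<delta>s. (a * u i) *s \<delta>s ! i) = a *s (\<Sum>i<length \<delta>s. u i *s \<delta>s ! i)"
    by (simp add: vmod.scale_sum_right vector_smult_assoc)
  then show "u \<in> relations \<delta>s \<Longrightarrow> (\<lambda>i. a * u i) \<in> relations \<delta>s"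
    by (simp add: relations_def free_mod_def)
qed

lemma hcomp_combination:
  assumes "graded_list es \<delta>s"
  shows "(\<chi> l. hcomp k ((\<Sum>i<length \<delta>s. u i *s \<delta>s ! i) $ l))
    = (\<Sum>i<length \<delta>s. hcomp (k - es ! i) (u i) *s \<delta>s ! i)"
proof -
  have "hcomp k (u i * \<delta>s ! i $ l) = hcomp (k - es ! i) (u i) * \<delta>s ! i $ l"
    if "i < length \<delta>s" for i l
    using assms that by (simp add: hcomp_mult_homogeneous graded_list_def homogeneous_der_def)
  then show ?thesis
    by (simp add: vec_eq_iff hcomp_sum)
qed

lemma relations_hcomp:
  assumes "graded_list es \<delta>s" "u \<in> relations \<delta>s"
  shows "(\<lambda>i. hcomp (k - es ! i) (u i)) \<in> relations \<delta>s"
  using hcomp_combination[OF assms(1), of k u] assms(2)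
  by (simp add: relations_def free_mod_def hcomp_zero vec_eq_iff)

text \<open>If a relation has a nonzero constant term at \<open>i\<close>, so does its graded
  component of degree \<open>es ! i\<close>, whose entry at \<open>i\<close> is exactly that
  constant. Dividing by it expresses \<open>\<delta>s ! i\<close> through the other
  generators.\<close>

lemma minimal_relationsI:
  fixes \<delta>s :: "('v::finite) derivation list"
  assumes graded: "graded_list es \<delta>s"
    and irredundant: "\<And>i. i < length \<delta>s \<Longrightarrow>
      \<delta>s ! i \<notin> vmod.span {\<delta>s ! j | j. j < length \<delta>s \<and> j \<noteq> i}"
  shows "minimal_relations \<delta>s"
  unfolding minimal_relations_def
proof (intro ballI allI, rule ccontr)
  fix u i
  assume u: "u \<in> relations \<delta>s" and nz: "const_term (u i) \<noteq> 0"
  define c where "c = const_term (u i)"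
  define w where "w j = hcomp (es ! i - es ! j) (u j)" for j
  have i: "i < length \<delta>s"
    using u nz by (auto simp: relations_def free_mod_def not_less[symmetric])
  have wi: "w i = Poly_Mapping.single 0 c"
    using homogeneous_hcomp[of 0 "u i"] by (simp add: w_def c_def homogeneous_0_iff const_term_hcomp_0)
  have "w \<in> relations \<delta>s"
    unfolding w_def using graded u by (rule relations_hcomp)
  then have "w i *s \<delta>s ! i + (\<Sum>j\<in>{..<length \<delta>s} - {i}. w j *s \<delta>s ! j) = 0"
    using i by (simp add: relations_def sum.remove[of _ i])
  then have "w i *s \<delta>s ! i = (\<Sum>j\<in>{..<length \<delta>s} - {i}. (- w j) *s \<delta>s ! j)"
    by (simp add: eq_neg_iff_add_eq_0 sum_negf)
  moreover have "\<dots> \<in> vmod.span {\<delta>s ! j | j. j < length \<delta>s \<and> j \<noteq> i}"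
    by (intro vmod.span_sum vmod.span_scale vmod.span_base) auto
  ultimately have "w i *s \<delta>s ! i \<in> vmod.span {\<delta>s ! j | j. j < length \<delta>s \<and> j \<noteq> i}"
    by simp
  then have "Poly_Mapping.single 0 (1 / c) *s (w i *s \<delta>s ! i)
      \<in> vmod.span {\<delta>s ! j | j. j < length \<delta>s \<and> j \<noteq> i}"
    by (rule vmod.span_scale)
  moreover have "Poly_Mapping.single 0 (1 / c) * w i = 1"
    using nz by (simp add: wi mult_single c_def)
  ultimately show False
    using irredundant[OF i] by (simp add: vector_smult_assoc)
qed

lemma minimal_generatorsD:
  assumes "minimal_generators h es \<delta>s"
  shows "graded_list es \<delta>s" "minimal_relations \<delta>s" "vmod.span (set \<delta>s) = D0 h"
proof -
  show "graded_list es \<delta>s" "vmod.span (set \<delta>s) = D0 h"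
    using assms by (simp_all add: minimal_generators_def graded_list_def)
  then show "minimal_relations \<delta>s"
    using assms by (intro minimal_relationsI) (auto simp: minimal_generators_def)
qed

text \<open>Keeping only the component of the right degree in each coefficient makes the transition
  matrix graded. As \<open>hcomp\<close> always returns a form, the degree condition holds even for
  indices out of range.\<close>

lemma homogeneous_transition:
  assumes "graded_list ds \<delta>s" "graded_list es \<rho>s" "set \<delta>s \<subseteq> vmod.span (set \<rho>s)"
  obtains P where
    "\<And>i. i < length \<delta>s \<Longrightarrow> \<delta>s ! i = (\<Sum>j<length \<rho>s. P i j *s \<rho>s ! j)"
    "\<And>i j. homogeneous (ds ! i - es ! j) (P i j)"
proof -
  have "\<forall>i. \<exists>u. i < length \<delta>s \<longrightarrow> \<delta>s ! i = (\<Sum>j<length \<rho>s. u j *s \<rho>s ! j)"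
    using assms(3) nth_mem span_set_iff by blast
  from choice[OF this] obtain P where
    P: "\<And>i. i < length \<delta>s \<Longrightarrow> \<delta>s ! i = (\<Sum>j<length \<rho>s. P i j *s \<rho>s ! j)"
    by blast
  show ?thesis
  proof
    show "homogeneous (ds ! i - es ! j) (hcomp (ds ! i - es ! j) (P i j))" for i j
      by (rule homogeneous_hcomp)
    fix i
    assume i: "i < length \<delta>s"
    have "\<delta>s ! i = (\<chi> l. hcomp (ds ! i) (\<delta>s ! i $ l))"
      using assms(1) i by (simp add: vec_eq_iff graded_list_def homogeneous_der_def homogeneous_iff_hcomp)
    also have "\<dots> = (\<Sum>j<length \<rho>s. hcomp (ds ! i - es ! j) (P i j) *s \<rho>s ! j)"
      using hcomp_combination[OF assms(2), of "ds ! i" "P i"] P[OF i] by simp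
    finally show "\<delta>s ! i = (\<Sum>j<length \<rho>s. hcomp (ds ! i - es ! j) (P i j) *s \<rho>s ! j)" .
  qed
qed

lemma combination_transition:
  fixes \<delta>s \<rho>s :: "('a::comm_ring_1 ^ 'n) list"
  assumes "\<And>i. i < length \<delta>s \<Longrightarrow> \<delta>s ! i = (\<Sum>j<length \<rho>s. P i j *s \<rho>s ! j)"
  shows "(\<Sum>i<length \<delta>s. u i *s \<delta>s ! i) = (\<Sum>j<length \<rho>s. (\<Sum>i<length \<delta>s. u i * P i j) *s \<rho>s ! j)"
proof -
  have "(\<Sum>i<length \<delta>s. u i *s \<delta>s ! i) = (\<Sum>i<length \<delta>s. \<Sum>j<length \<rho>s. (u i * P i j) *s \<rho>s ! j)"
    using assms by (simp add: vmod.scale_sum_right vector_smult_assoc)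
  also have "\<dots> = (\<Sum>j<length \<rho>s. \<Sum>i<length \<delta>s. (u i * P i j) *s \<rho>s ! j)"
    by (rule sum.swap)
  finally show ?thesis
    by (simp add: vmod.scale_sum_left)
qed

text \<open>
  Passing from \<open>\<rho>s\<close> to \<open>\<delta>s\<close> and back differs from the identity by relations among \<open>\<rho>s\<close>.
\<close>

lemma transition_row_in_relations:
  fixes \<delta>s \<rho>s :: "('v::finite) derivation list"
  assumes P: "\<And>i. i < length \<delta>s \<Longrightarrow> \<delta>s ! i = (\<Sum>j<length \<rho>s. P i j *s \<rho>s ! j)"
    and Q: "\<And>j. j < length \<rho>s \<Longrightarrow> \<rho>s ! j = (\<Sum>i<length \<delta>s. Q j i *s \<delta>s ! i)"
    and j: "j < length \<rho>s"
  shows "(\<lambda>l. if l < length \<rho>s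
      then (\<Sum>i<length \<delta>s. Q j i * P i l) - (if l = j then 1 else 0) else 0) \<in> relations \<rho>s"
proof -
  have "\<rho>s ! j = (\<Sum>l<length \<rho>s. (\<Sum>i<length \<delta>s. Q j i * P i l) *s \<rho>s ! l)"
    using Q[OF j] combination_transition[where \<rho>s = \<rho>s and P = P and u = "Q j", OF P] by simp
  moreover have "(\<Sum>l<length \<rho>s. (if l = j then 1 else 0) *s \<rho>s ! l) = \<rho>s ! j"
    using j by (simp add: if_distrib[of "\<lambda>a. a *s _"] cong: if_cong)
  ultimately have "(\<Sum>l<length \<rho>s. ((\<Sum>i<length \<delta>s. Q j i * P i l) - (if l = j then 1 else 0)) *s \<rho>s ! l) = 0"
    by (simp only: vmod.scale_left_diff_distrib sum_subtractf) simp
  then show ?thesis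
    by (simp add: relations_def free_mod_def)
qed

text \<open>The rows of \<open>Q P - 1\<close> are relations among \<open>\<rho>s\<close>, so
  minimality removes their constant terms. Only diagonal entries are recorded, because they suffice
  for a trace.\<close>

lemma transition_const_term:
  fixes \<delta>s \<rho>s :: "('v::finite) derivation list"
  assumes P: "\<And>i. i < length \<delta>s \<Longrightarrow> \<delta>s ! i = (\<Sum>j<length \<rho>s. P i j *s \<rho>s ! j)"
    and Q: "\<And>j. j < length \<rho>s \<Longrightarrow> \<rho>s ! j = (\<Sum>i<length \<delta>s. Q j i *s \<delta>s ! i)"
    and "minimal_relations \<rho>s" and j: "j < length \<rho>s"
  shows "(\<Sum>i<length \<delta>s. const_term (Q j i) * const_term (P i j)) = 1"
proof -
  have "\<forall>l. const_term (if l < length \<rho>s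
      then (\<Sum>i<length \<delta>s. Q j i * P i l) - (if l = j then 1 else 0) else 0) = 0"
    using assms(3)[unfolded minimal_relations_def] transition_row_in_relations[OF P Q j]
    by (rule bspec)
  from this[rule_format, of j] show ?thesis
    using j by (simp add: const_term.hom_diff const_term.hom_sum const_term.hom_mult)
qed

text \<open>
  With \<open>P\<close>, \<open>Q\<close> the constant parts of the transition matrices, the blocks of degree \<open>e\<close> satisfy
  \<open>Q P = 1\<close> and \<open>P Q = 1\<close>, so the block sizes agree by comparing traces.
\<close>

lemma minimal_degrees_unique:
  fixes \<delta>s \<rho>s :: "('v::finite) derivation list"
  assumes \<delta>: "graded_list ds \<delta>s" "minimal_relations \<delta>s"
    and \<rho>: "graded_list es \<rho>s" "minimal_relations \<rho>s"
    and span: "vmod.span (set \<delta>s) = vmod.span (set \<rho>s)"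
  shows "mset ds = mset es"
proof (rule multiset_eqI)
  fix e
  have sub: "set \<delta>s \<subseteq> vmod.span (set \<rho>s)" "set \<rho>s \<subseteq> vmod.span (set \<delta>s)"
    using span vmod.span_superset by blast+
  obtain P where P: "\<And>i. i < length \<delta>s \<Longrightarrow> \<delta>s ! i = (\<Sum>j<length \<rho>s. P i j *s \<rho>s ! j)"
    and Pdeg: "\<And>i j. homogeneous (ds ! i - es ! j) (P i j)"
    using homogeneous_transition[OF \<delta>(1) \<rho>(1) sub(1)] by blast
  obtain Q where Q: "\<And>j. j < length \<rho>s \<Longrightarrow> \<rho>s ! j = (\<Sum>i<length \<delta>s. Q j i *s \<delta>s ! i)"
    by (rule homogeneous_transition[OF \<rho>(1) \<delta>(1) sub(2)]) (rule that)
  define I where "I = {i. i < length \<delta>s \<and> ds ! i = e}"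
  define J where "J = {j. j < length \<rho>s \<and> es ! j = e}"
  have fin: "finite I" "finite J"
    by (auto simp: I_def J_def)
  \<comment> \<open>A graded matrix has nonzero constant terms only between generators of equal
    degree; this cuts the inner sums down to the block of degree \<open>e\<close>.\<close>
  have P0: "es ! j = ds ! i" if "const_term (P i j) \<noteq> 0" for i j
    using const_term_homogeneous[OF Pdeg, of i j] that by (metis eq_iff_diff_eq_0)
  have "of_nat (card J) = (\<Sum>j\<in>J. \<Sum>i<length \<delta>s. const_term (Q j i) * const_term (P i j))"
    using transition_const_term[OF P Q \<rho>(2)] by (simp add: J_def)
  also have "\<dots> = (\<Sum>j\<in>J. \<Sum>i\<in>I. const_term (Q j i) * const_term (P i j))"
    by (rule sum.cong[OF refl], rule sum.mono_neutral_right) (auto simp: I_def J_def dest: P0)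
  also have "\<dots> = (\<Sum>i\<in>I. \<Sum>j\<in>J. const_term (P i j) * const_term (Q j i))"
    by (subst sum.swap) (simp add: mult.commute)
  also have "\<dots> = (\<Sum>i\<in>I. \<Sum>j<length \<rho>s. const_term (P i j) * const_term (Q j i))"
    by (rule sum.cong[OF refl], rule sum.mono_neutral_left) (auto simp: I_def J_def dest: P0)
  also have "\<dots> = of_nat (card I)"
    using transition_const_term[OF Q P \<delta>(2)] by (simp add: I_def)
  finally have "card J = card I"
    by (simp only: of_nat_eq_iff)
  then show "count (mset ds) e = count (mset es) e"
    using \<delta>(1) \<rho>(1)
    by (simp add: I_def J_def graded_list_def count_mset count_list_eq_length_filter
        length_filter_conv_card
        eq_commute)
qed

text \<open>
  If \<open>w\<close> is a relation among \<open>\<rho>s\<close>, passing to \<open>\<delta>s\<close> and back changes it by a combination of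
  relations among \<open>\<rho>s\<close> whose coefficients, by minimality, have no constant term. Induction on
  the degree then shows that the generator \<open>u\<close> of the relations among \<open>\<delta>s\<close> induces a generator
  of the relations among \<open>\<rho>s\<close>.
\<close>

lemma cyclic_relations_transfer:
  fixes \<delta>s \<rho>s :: "('v::finite) derivation list"
  assumes \<delta>: "graded_list ds \<delta>s" and \<rho>: "graded_list es \<rho>s" "minimal_relations \<rho>s"
    and span: "vmod.span (set \<delta>s) = vmod.span (set \<rho>s)"
    and u: "relations \<delta>s = {(\<lambda>i. a * u i) | a. True}"
    and udeg: "\<And>i. i < length \<delta>s \<Longrightarrow> homogeneous (c - ds ! i) (u i)"
  obtains v where "relations \<rho>s = {(\<lambda>i. a * v i) | a. True}"
    "\<And>i. i < length \<rho>s \<Longrightarrow> homogeneous (c - es ! i) (v i)"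
    "\<And>i. u = (\<lambda>_. 0) \<Longrightarrow> v i = 0"
proof -
  let ?n = "length \<delta>s" and ?m = "length \<rho>s"
  have sub: "set \<delta>s \<subseteq> vmod.span (set \<rho>s)" "set \<rho>s \<subseteq> vmod.span (set \<delta>s)"
    using span vmod.span_superset by blast+
  obtain P where P: "\<And>i. i < ?n \<Longrightarrow> \<delta>s ! i = (\<Sum>j<?m. P i j *s \<rho>s ! j)"
    and Pdeg: "\<And>i j. homogeneous (ds ! i - es ! j) (P i j)"
    using homogeneous_transition[OF \<delta>(1) \<rho>(1) sub(1)] by blast
  obtain Q where Q: "\<And>j. j < ?m \<Longrightarrow> \<rho>s ! j = (\<Sum>i<?n. Q j i *s \<delta>s ! i)"
    and Qdeg: "\<And>j i. homogeneous (es ! j - ds ! i) (Q j i)"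
    using homogeneous_transition[OF \<rho>(1) \<delta>(1) sub(2)] by blast
  define row where "row j = (\<lambda>l. if l < ?m
    then (\<Sum>i<?n. Q j i * P i l) - (if l = j then 1 else 0) else 0)" for j
  have row_rel: "row j \<in> relations \<rho>s" if "j < ?m" for j
    using transition_row_in_relations[OF P Q that] by (simp add: row_def)
  have row_deg: "homogeneous (es ! j - es ! l) (row j l)" for j l
  proof -
    have "homogeneous (es ! j - es ! l) (Q j i * P i l)" for i
      using homogeneous_mult[OF Qdeg[of j i] Pdeg[of i l]] by simp
    then have "homogeneous (es ! j - es ! l) (\<Sum>i<?n. Q j i * P i l)"
      by (intro homogeneous_sum)
    then show ?thesis
      using homogeneous_of_nat[of 1]
      by (auto simp: row_def homogeneous_zero intro!: homogeneous_diff)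
  qed
  \<comment> \<open>The candidate generator: the image of \<open>u\<close> under the transition
    matrix \<open>P\<close>.\<close>
  define v where "v l = (if l < ?m then \<Sum>i<?n. u i * P i l else 0)" for l
  have vdeg: "homogeneous (c - es ! l) (v l)" for l
  proof -
    have "homogeneous (c - es ! l) (u i * P i l)" if "i < ?n" for i
      using homogeneous_mult[OF udeg[OF that] Pdeg[of i l]] by simp
    then show ?thesis
      by (auto simp: v_def homogeneous_zero intro!: homogeneous_sum)
  qed
  have "(\<lambda>i. 1 * u i) \<in> relations \<delta>s"
    using u by blast
  then have vrel: "v \<in> relations \<rho>s"
    using combination_transition[where \<rho>s = \<rho>s and P = P and u = u, OF P]
    by (simp add: relations_def free_mod_def v_def)
  \<comment> \<open>A lower bound for the degrees of \<open>\<rho>s\<close>, so that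
    \<open>nat (k - b)\<close> can measure the degree \<open>k\<close> of a relation in the
    induction.\<close>
  obtain b where b: "\<And>j. j < ?m \<Longrightarrow> b \<le> es ! j"
    using \<rho>(1) bdd_below_finite[of "set es"] by (metis List.finite_set bdd_below_def graded_list_def nth_mem)
  have homog: "\<exists>a. w = (\<lambda>l. a * v l)"
    if "w \<in> relations \<rho>s" "\<And>j. j < ?m \<Longrightarrow> homogeneous (k - es ! j) (w j)" for w k
    using that
  proof (induction "nat (k - b)" arbitrary: k w rule: less_induct)
    case less
    have w0: "w l = 0" if "\<not> l < ?m" for l
      using less.prems(1) that by (simp add: relations_def free_mod_def)
    \<comment> \<open>Rewritten in terms of \<open>\<delta>s\<close>, the relation \<open>w\<close>
      becomes a multiple of \<open>u\<close>; passing back turns this into a multiple of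
      \<open>v\<close>.\<close>
    define t where "t i = (if i < ?n then \<Sum>j<?m. w j * Q j i else 0)" for i
    have "t \<in> relations \<delta>s"
      using combination_transition[where \<rho>s = \<delta>s and P = Q and u = w, OF Q] less.prems(1)
      by (simp add: relations_def free_mod_def t_def)
    then obtain a where a: "\<And>i. t i = a * u i"
      by (auto simp: u)
    have "\<exists>a'. \<forall>l. w j * row j l = a' * v l" if j: "j < ?m" for j
    proof (cases "w j = 0")
      case False
      \<comment> \<open>Having no constant term, a nonzero \<open>w j\<close> has positive degree
        \<open>k - es ! j\<close>. So the relation \<open>row j\<close>, of degree
        \<open>es ! j\<close>, falls under the induction hypothesis.\<close>
      have "const_term (w j) = 0"
        using \<rho>(2) less.prems(1) by (simp add: minimal_relations_def)
      then have "k - es ! j \<noteq> 0"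
        using less.prems(2)[OF j] False by (metis homogeneous_0_iff single_zero)
      moreover have "\<not> k - es ! j < 0"
        using less.prems(2)[OF j] False homogeneous_neg_eq_0 by blast
      ultimately have "nat (es ! j - b) < nat (k - b)"
        using b[OF j] by linarith
      then obtain a' where "row j = (\<lambda>l. a' * v l)"
        using less.hyps[OF _ row_rel[OF j] row_deg] by blast
      then have "\<forall>l. w j * row j l = (w j * a') * v l"
        by (simp add: mult.assoc)
      then show ?thesis by blast
    qed (auto intro: exI[of _ 0])
    then obtain a' where a': "\<And>j l. j < ?m \<Longrightarrow> w j * row j l = a' j * v l"
      by metis
    have "w l = (a - (\<Sum>j<?m. a' j)) * v l" for l
    proof (cases "l < ?m")
      case True
      \<comment> \<open>The passage to \<open>\<delta>s\<close> and back sends \<open>w\<close> to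
        \<open>w\<close> plus the combination of the rows with coefficients
        \<open>w j\<close>.\<close>
      have "(\<Sum>j<?m. w j * row j l) = (\<Sum>j<?m. \<Sum>i<?n. w j * Q j i * P i l) - w l"
        using True
        by (simp add: row_def right_diff_distrib sum_subtractf sum_distrib_left mult.assoc
            if_distrib[of "\<lambda>x. _ * x"] cong: if_cong)
      also have "(\<Sum>j<?m. \<Sum>i<?n. w j * Q j i * P i l) = (\<Sum>i<?n. t i * P i l)"
        by (subst sum.swap) (simp add: t_def sum_distrib_right)
      also have "\<dots> = a * v l"
        using True by (simp add: a v_def sum_distrib_left mult.assoc)
      finally have "w l = a * v l - (\<Sum>j<?m. w j * row j l)"
        by simp
      then show ?thesis
        by (simp add: a' left_diff_distrib sum_distrib_right)
    qed (simp add: w0 v_def)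
    then show ?case by blast
  qed
  have "\<exists>a. w = (\<lambda>l. a * v l)" if w: "w \<in> relations \<rho>s" for w
  proof -
    have "\<exists>a. (\<lambda>l. hcomp (k - es ! l) (w l)) = (\<lambda>l. a * v l)" for k
      by (rule homog[OF relations_hcomp[OF \<rho>(1) w]]) (rule homogeneous_hcomp)
    then obtain a where a: "\<And>k l. hcomp (k - es ! l) (w l) = a k * v l"
      by metis
    \<comment> \<open>All total degrees in which \<open>w\<close> has a component; the multipliers
      found for these degrees are added up.\<close>
    define K where "K = (\<Union>l<?m. (\<lambda>t. int (mono_degree t) + es ! l) ` Poly_Mapping.keys (w l))"
    have "w l = (\<Sum>k\<in>K. a k) * v l" for l
    proof (cases "l < ?m")
      case True
      then have "(\<Sum>k\<in>K. hcomp (k - es ! l) (w l)) = w l"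
        by (intro sum_hcomp_shifted) (auto simp: K_def)
      then show ?thesis
        by (simp add: a sum_distrib_right)
    next
      case False
      then show ?thesis
        using w by (simp add: relations_def free_mod_def v_def)
    qed
    then show ?thesis by blast
  qed
  moreover have "(\<lambda>l. a * v l) \<in> relations \<rho>s" for a
    using vrel by (rule relations_smult)
  ultimately have "relations \<rho>s = {(\<lambda>i. a * v i) | a. True}"
    by blast
  then show thesis
    by (rule that[of v]) (simp_all add: vdeg, simp add: v_def)
qed

text \<open>A basis witnessing freeness is not assumed finite. This picks out a finite part of it
  that already spans a given finite set of generators.\<close>

lemma finite_subset_spans:
  fixes B :: "('a::comm_ring_1 ^ 'n) set"
  assumes "finite S" "S \<subseteq> vmod.span B"
  obtains T where "finite T" "T \<subseteq> B" "S \<subseteq> vmod.span T"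
proof -
  have "\<exists>T. finite T \<and> T \<subseteq> B \<and> S \<subseteq> vmod.span T"
    using assms
  proof (induction S rule: finite_induct)
    case (insert x S)
    then obtain T where T: "finite T" "T \<subseteq> B" "S \<subseteq> vmod.span T"
      by auto
    obtain U r where U: "finite U" "U \<subseteq> B" "x = (\<Sum>a\<in>U. r a *s a)"
      using insert.prems by (auto simp: vmod.span_explicit)
    have "x \<in> vmod.span U"
      unfolding U(3) by (intro vmod.span_sum vmod.span_scale vmod.span_base)
    then have "insert x S \<subseteq> vmod.span (T \<union> U)"
      using T(3) vmod.span_mono[of T "T \<union> U"] vmod.span_mono[of U "T \<union> U"] by auto
    then show ?case
      using T U by (intro exI[of _ "T \<union> U"]) auto
  qed auto
  then show thesis using that by blast
qed

lemma relations_independent: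
  assumes "vmod.independent (set bs)" "distinct bs"
  shows "relations bs = {\<lambda>_. 0}"
proof -
  have "u i = 0" if u: "u \<in> relations bs" for u i
  proof (cases "i < length bs")
    case i: True
    \<comment> \<open>Independence concerns coefficients attached to vectors,
      \<open>relations\<close> coefficients attached to positions; distinctness makes them
      interchangeable.\<close>
    define f where "f x = u (inv_into {..<length bs} ((!) bs) x)" for x
    have inj: "inj_on ((!) bs) {..<length bs}"
      using assms(2) by (simp add: inj_on_nth)
    have f: "f (bs ! j) = u j" if "j < length bs" for j
      using inv_into_f_f[OF inj] that by (simp add: f_def)
    have "(\<Sum>x\<in>set bs. f x *s x) = (\<Sum>j<length bs. u j *s bs ! j)"
      unfolding set_eq_image_nth by (subst sum.reindex[OF inj]) (simp add: f)
    also have "\<dots> = 0"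
      using u by (simp add: relations_def)
    finally have "f (bs ! i) = 0"
      using vmod.independentD[OF assms(1), of "set bs" f "bs ! i"] i by simp
    then show ?thesis
      using f[OF i] by simp
  qed (use u in \<open>simp add: relations_def free_mod_def\<close>)
  moreover have "(\<lambda>_. 0) \<in> relations bs"
    by (simp add: relations_def free_mod_def)
  ultimately show ?thesis by blast
qed

text \<open>Freeness provides some homogeneous basis, unrelated to \<open>rs\<close>. Its relations
  are trivial, and triviality passes to \<open>rs\<close> as the case \<open>u = 0\<close> of
  \<open>cyclic_relations_transfer\<close>.\<close>

lemma free_hypersurface_iff:
  fixes rs :: "('v::finite) derivation list"
  assumes rs: "minimal_generators h es rs"
  shows "free_hypersurface h \<longleftrightarrow> relations rs = {\<lambda>_. 0}"
proof
  assume "free_hypersurface h"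
  then obtain B where B: "B \<subseteq> D0 h" "\<And>\<delta>. \<delta> \<in> B \<Longrightarrow> \<exists>k. homogeneous_der k \<delta>"
    "vmod.independent B" "vmod.span B = D0 h"
    by (auto simp: free_hypersurface_def)
  have "set rs \<subseteq> vmod.span B"
    using vmod.span_superset minimal_generatorsD(3)[OF rs] B(4) by metis
  then obtain T where T: "finite T" "T \<subseteq> B" "set rs \<subseteq> vmod.span T"
    by (rule finite_subset_spans[rotated]) auto
  obtain bs where bs: "set bs = T" "distinct bs"
    using finite_distinct_list[OF T(1)] by blast
  obtain k where k: "\<And>\<delta>. \<delta> \<in> B \<Longrightarrow> homogeneous_der (k \<delta>) \<delta>"
    using B(2) by metis
  have graded: "graded_list (map k bs) bs"
    using k T(2) bs(1) by (auto simp: graded_list_def subset_eq)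
  have span: "vmod.span (set bs) = vmod.span (set rs)"
    unfolding bs minimal_generatorsD(3)[OF rs]
  proof
    show "vmod.span T \<subseteq> D0 h"
      using vmod.span_mono[OF T(2)] B(4) by simp
    show "D0 h \<subseteq> vmod.span T"
      using vmod.span_mono[OF T(3)] minimal_generatorsD(3)[OF rs] by (simp add: vmod.span_span)
  qed
  have rel: "relations bs = {(\<lambda>i. a * (\<lambda>_. 0) i) | a. True}"
    using relations_independent[OF _ bs(2)] vmod.independent_mono[OF B(3) T(2)] bs(1) by simp
  show "relations rs = {\<lambda>_. 0}"
  proof (rule cyclic_relations_transfer[OF graded minimal_generatorsD(1,2)[OF rs] span rel, where c = 0])
    fix v
    assume "relations rs = {(\<lambda>i. a * v i) | a. True}" "\<And>i. (\<lambda>_. 0) = (\<lambda>_. 0) \<Longrightarrow> v i = 0"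
    then show ?thesis by simp
  qed (rule homogeneous_zero)
next
  assume rel: "relations rs = {\<lambda>_. 0}"
  have gens: "\<forall>i<length rs. rs ! i \<in> D0 h \<and> homogeneous_der (es ! i) (rs ! i)"
    using rs by (simp add: minimal_generators_def)
  \<comment> \<open>Independence is a property of the set of generators, so coincidences in the list
    must be excluded first; irredundance does this.\<close>
  have "distinct rs"
  proof (rule ccontr)
    assume "\<not> distinct rs"
    then obtain i j where "i < length rs" "j < length rs" "i \<noteq> j" "rs ! i = rs ! j"
      by (auto simp: distinct_conv_nth)
    then have "rs ! i \<in> {rs ! j | j. j < length rs \<and> j \<noteq> i}"
      by (metis (mono_tags, lifting) mem_Collect_eq)
    then have "rs ! i \<in> vmod.span {rs ! j | j. j < length rs \<and> j \<noteq> i}"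
      by (rule vmod.span_base)
    then show False
      using rs \<open>i < length rs\<close> by (simp add: minimal_generators_def)
  qed
  have "f x = 0" if f: "(\<Sum>x\<in>set rs. f x *s x) = 0" and x: "x \<in> set rs" for f x
  proof -
    define u where "u i = (if i < length rs then f (rs ! i) else 0)" for i
    have "(\<Sum>i<length rs. u i *s rs ! i) = (\<Sum>x\<in>set rs. f x *s x)"
      unfolding set_eq_image_nth
      by (subst sum.reindex) (use \<open>distinct rs\<close> in \<open>simp_all add: inj_on_nth u_def\<close>)
    then have "u \<in> relations rs"
      using f by (simp add: relations_def free_mod_def u_def)
    then have u0: "u i = 0" for i
      using rel by simp
    obtain i where "i < length rs" "x = rs ! i"
      using x by (auto simp: in_set_conv_nth)
    then show ?thesis
      using u0[of i] by (simp add: u_def)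
  qed
  then have "vmod.independent (set rs)"
    by (auto simp: vmod.dependent_finite)
  moreover have "set rs \<subseteq> D0 h" "\<forall>\<delta>\<in>set rs. \<exists>k. homogeneous_der k \<delta>"
    using gens by (metis in_set_conv_nth subsetI)+
  ultimately show "free_hypersurface h"
    unfolding free_hypersurface_def using minimal_generatorsD(3)[OF rs] by blast
qed

section \<open>The polynomial ring of the cone as a univariate polynomial ring\<close>

lemma homogeneous_msubst:
  fixes X :: "'v::finite \<Rightarrow> 'u::finite mpol"
  assumes X: "\<And>i. homogeneous 1 (X i)" and p: "homogeneous k p"
  shows "homogeneous k (msubst (Poly_Mapping.single 0) X p)"
proof -
  have "homogeneous k (msubst (Poly_Mapping.single 0) X (hcomp k q))" for q
  proof (induction q rule: poly_mapping_single_add_induct)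
    case (single t a)
    have "homogeneous (0 + (\<Sum>i\<in>UNIV. int (Poly_Mapping.lookup t i)))
        (Poly_Mapping.single 0 a * (\<Prod>i\<in>UNIV. X i ^ Poly_Mapping.lookup t i))"
      by (intro homogeneous_mult homogeneous_const homogeneous_prod homogeneous_power X)
    then show ?case
      by (auto simp: hcomp_single msubst_single[OF cring_hom_const_mpol] mono_degree_eq_sum
          msubst_def[of _ _ 0] homogeneous_zero)
  qed (simp add: hcomp_add msubst_add[OF cring_hom_const_mpol] homogeneous_add)
  then show ?thesis
    using p by (metis homogeneous_iff_hcomp)
qed

lemma incl_eq_msubst: "incl = msubst (Poly_Mapping.single 0) (\<lambda>i. indet (Some i))"
  by (simp add: fun_eq_iff incl_def msubst_def)

lemma cring_hom_incl: "cring_hom incl"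
  unfolding incl_eq_msubst by (rule cring_hom_msubst[OF cring_hom_const_mpol])

interpretation incl: cring_hom incl
  by (rule cring_hom_incl)

lemma incl_const: "incl (Poly_Mapping.single 0 a) = Poly_Mapping.single 0 a"
  by (simp add: incl_eq_msubst msubst_const[OF cring_hom_const_mpol])

lemma incl_indet: "incl (indet i) = indet (Some i)"
  by (simp add: incl_eq_msubst msubst_indet[OF cring_hom_const_mpol])

lemma homogeneous_incl: "homogeneous k p \<Longrightarrow> homogeneous k (incl p)"
  unfolding incl_eq_msubst by (rule homogeneous_msubst[OF homogeneous_indet])

lemma const_term_indet: "const_term (indet i :: 'v mpol) = 0"
proof -
  have "Poly_Mapping.single i (1::nat) \<noteq> 0"
    by (metis lookup_single_eq lookup_zero zero_neq_one)
  then show ?thesis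
    by (simp add: indet_def lookup_single when_def)
qed

lemma const_term_incl: "const_term (incl p) = const_term p"
  by (rule cring_hom_mpol_ext[OF cring_hom_comp[OF cring_hom_const_term cring_hom_incl] cring_hom_const_term])
    (simp_all add: incl_const incl_indet const_term_indet)

text \<open>Reads an element of S as a polynomial in \<open>w\<close> over R. Statements over S are
  reduced to R through its coefficients.\<close>

definition wpoly :: "('v::finite) option mpol \<Rightarrow> 'v mpol poly" where
  "wpoly = msubst (\<lambda>a. [:Poly_Mapping.single 0 a:])
     (\<lambda>i. case i of None \<Rightarrow> [:0, 1:] | Some k \<Rightarrow> [:indet k:])"

lemma cring_hom_const_mpol_poly:
  "cring_hom (\<lambda>a. [:Poly_Mapping.single (0 :: 'v \<Rightarrow>\<^sub>0 nat) (a :: complex):])"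
  by (rule cring_hom_comp[OF cring_hom_const_poly cring_hom_const_mpol])

lemma cring_hom_wpoly: "cring_hom wpoly"
  unfolding wpoly_def by (rule cring_hom_msubst[OF cring_hom_const_mpol_poly])

interpretation wpoly: cring_hom wpoly
  by (rule cring_hom_wpoly)

lemma wpoly_const: "wpoly (Poly_Mapping.single 0 a) = [:Poly_Mapping.single 0 a:]"
  by (simp add: wpoly_def msubst_const[OF cring_hom_const_mpol_poly])

lemma wpoly_indet: "wpoly (indet i) = (case i of None \<Rightarrow> [:0, 1:] | Some k \<Rightarrow> [:indet k:])"
  by (simp add: wpoly_def msubst_indet[OF cring_hom_const_mpol_poly])

lemma wpoly_incl: "wpoly (incl p) = [:p:]"
  by (rule cring_hom_mpol_ext[OF cring_hom_comp[OF cring_hom_wpoly cring_hom_incl] cring_hom_const_poly])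
    (simp_all add: incl_const incl_indet wpoly_const wpoly_indet)

text \<open>An explicit left inverse of \<open>wpoly\<close>. It yields injectivity, so elements of
  S may be compared coefficient by coefficient.\<close>

lemma poly_wpoly: "poly (map_poly incl (wpoly s)) (indet None) = s"
proof (rule cring_hom_mpol_ext[OF cring_hom_comp[OF cring_hom_poly_eval[OF cring_hom_incl] cring_hom_wpoly]
      cring_hom_id])
  show "poly (map_poly incl (wpoly (indet i))) (indet None) = indet i" for i
    by (cases i) (simp_all add: wpoly_indet poly_map_poly_const[OF cring_hom_incl]
        poly_map_poly_X[OF cring_hom_incl] incl_indet)
qed (simp add: wpoly_const poly_map_poly_const[OF cring_hom_incl] incl_const)

lemma wpoly_eq_iff: "wpoly s = wpoly t \<longleftrightarrow> s = t"
  by (metis poly_wpoly)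

lemma wpoly_eq_0_iff: "wpoly s = 0 \<longleftrightarrow> s = 0"
  using wpoly_eq_iff[of s 0] by (simp add: wpoly.hom_zero)

lemma incl_eq_0_iff: "incl p = 0 \<longleftrightarrow> p = 0"
  using wpoly_eq_0_iff[of "incl p"] by (simp add: wpoly_incl)

lemma wpoly_indet_None_mult: "wpoly (indet None * s) = pCons 0 (wpoly s)"
  by (simp add: wpoly.hom_mult wpoly_indet)

lemma indet_None_mult_eq_0_iff: "indet None * s = 0 \<longleftrightarrow> s = (0 :: ('v::finite) option mpol)"
  by (metis mult_zero_right pCons_eq_0_iff wpoly_eq_0_iff wpoly_indet_None_mult)

lemma coeff_wpoly_incl_mult: "poly.coeff (wpoly (s * incl p)) k = poly.coeff (wpoly s) k * p"
  by (simp add: wpoly.hom_mult wpoly_incl mult.commute[of _ "[:p:]"] mult.commute)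

lemma homogeneous_coeff_wpoly_0:
  assumes "homogeneous k s"
  shows "homogeneous k (poly.coeff (wpoly s) 0)"
proof -
  \<comment> \<open>Taking the coefficient of \<open>w^0\<close> is the substitution
    \<open>w = 0\<close>. It respects degrees because 0 counts as homogeneous of degree 1.\<close>
  let ?X = "\<lambda>i. case i of None \<Rightarrow> 0 | Some j \<Rightarrow> indet j"
  have "poly.coeff (wpoly s) 0 = msubst (Poly_Mapping.single 0) ?X s"
    by (rule cring_hom_mpol_ext[OF cring_hom_comp[OF cring_hom_coeff_0 cring_hom_wpoly]
          cring_hom_msubst[OF cring_hom_const_mpol]])
      (simp_all add: wpoly_const wpoly_indet msubst_const[OF cring_hom_const_mpol]
        msubst_indet[OF cring_hom_const_mpol] split: option.split)
  moreover have "homogeneous 1 (?X i)" for i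
    by (simp add: homogeneous_zero homogeneous_indet split: option.split)
  ultimately show ?thesis
    using homogeneous_msubst assms by metis
qed

section \<open>Derivations killing the cone\<close>

lemma sum_option: "(\<Sum>i\<in>UNIV. f i) = f None + (\<Sum>k\<in>(UNIV :: 'v::finite set). f (Some k))"
  by (simp add: UNIV_option_conv sum.reindex)

lemma partial_deriv_cone_poly:
  fixes g :: "'v::finite mpol"
  shows "partial_deriv (Some i) (cone_poly g) = indet None * incl (partial_deriv i g)"
    and "partial_deriv None (cone_poly g) = incl g"
proof -
  \<comment> \<open>The exponent vector extended by 0 at \<open>w\<close>; with it,
    \<open>incl\<close> and \<open>cone_poly\<close> send single terms to single terms.\<close>
  define emb :: "('v \<Rightarrow>\<^sub>0 nat) \<Rightarrow> 'v option \<Rightarrow>\<^sub>0 nat" where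
    "emb t = (\<Sum>i\<in>UNIV. Poly_Mapping.single (Some i) (Poly_Mapping.lookup t i))" for t
  have emb: "Poly_Mapping.lookup (emb t) None = 0" "Poly_Mapping.lookup (emb t) (Some i) = Poly_Mapping.lookup t i"
    for t i
    by (simp_all add: emb_def lookup_sum lookup_single when_def)
  have incl_single: "incl (Poly_Mapping.single t a) = Poly_Mapping.single (emb t) a" for t a
    by (simp add: incl_eq_msubst msubst_single[OF cring_hom_const_mpol] indet_power prod_single_one
        mult_single emb_def)
  have cone_single: "cone_poly (Poly_Mapping.single t a)
      = Poly_Mapping.single (Poly_Mapping.single None 1 + emb t) a" for t a
    by (simp add: cone_poly_def incl_single indet_def mult_single)
  have cone_add: "cone_poly (p + q) = cone_poly p + cone_poly q" for p q :: "'v mpol"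
    by (simp add: cone_poly_def incl.hom_add distrib_left)
  show "partial_deriv (Some i) (cone_poly g) = indet None * incl (partial_deriv i g)"
  proof (induction g rule: poly_mapping_single_add_induct)
    case (single t a)
    show ?case
    proof (cases "Poly_Mapping.lookup t i = 0")
      case False
      have "Poly_Mapping.single None 1 + emb t - Poly_Mapping.single (Some i) 1
          = Poly_Mapping.single None 1 + emb (t - Poly_Mapping.single i 1)"
      proof (rule poly_mapping_eqI)
        fix k
        show "Poly_Mapping.lookup (Poly_Mapping.single None 1 + emb t - Poly_Mapping.single (Some i) 1) k
          = Poly_Mapping.lookup (Poly_Mapping.single None 1 + emb (t - Poly_Mapping.single i 1)) k"
          using False
          by (cases k) (auto simp: lookup_add lookup_minus lookup_single when_def emb)
      qed
      then show ?thesis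
        by (simp add: cone_single partial_deriv_single incl_single indet_def mult_single lookup_add
            lookup_single emb)
    qed (simp add: cone_single partial_deriv_single incl_single lookup_add lookup_single emb incl.hom_zero)
  qed (simp add: cone_add partial_deriv_add incl.hom_add distrib_left)
  show "partial_deriv None (cone_poly g) = incl g"
  proof (induction g rule: poly_mapping_single_add_induct)
    case (single t a)
    show ?case
      by (simp add: cone_single partial_deriv_single incl_single lookup_add lookup_single emb)
  qed (simp add: cone_add partial_deriv_add incl.hom_add)
qed

lemma D0_cone_iff:
  "\<tau> \<in> D0 (cone_poly g) \<longleftrightarrow>
     \<tau> $ None * incl g + indet None * (\<Sum>i\<in>UNIV. \<tau> $ Some i * incl (partial_deriv i g)) = 0"
  by (simp add: D0_def sum_option partial_deriv_cone_poly sum_distrib_left mult.left_commute)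

lemma subspace_D0: "vmod.subspace (D0 h)"
  by (auto simp: vmod.subspace_def D0_def distrib_right sum.distrib mult.assoc simp flip: sum_distrib_left)

text \<open>The component at \<open>w\<close> is dropped, so the slices determine
  \<open>\<tau>\<close> only together with \<open>\<tau> $ None\<close>.\<close>

definition slice :: "nat \<Rightarrow> ('v::finite) option derivation \<Rightarrow> 'v derivation" where
  "slice k \<tau> = (\<chi> i. poly.coeff (wpoly (\<tau> $ Some i)) k)"

lemma lift_der_nth: "lift_der r $ None = 0" "lift_der r $ Some i = incl (r $ i)"
  by (simp_all add: lift_der_def)

lemma slice_sum: "slice k (\<Sum>i\<in>A. f i) = (\<Sum>i\<in>A. slice k (f i))"
  by (simp add: slice_def vec_eq_iff wpoly.hom_sum coeff_sum)

lemma slice_smult_lift: "slice k (s *s lift_der r) = poly.coeff (wpoly s) k *s r"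
  by (simp add: slice_def vec_eq_iff lift_der_nth coeff_wpoly_incl_mult)

lemma slice_zero: "slice k 0 = 0"
  by (simp add: slice_def vec_eq_iff wpoly.hom_zero)

lemma slice_eqI:
  assumes "\<sigma> $ None = \<tau> $ None" "\<And>k. slice k \<sigma> = slice k \<tau>"
  shows "\<sigma> = \<tau>"
proof -
  have "\<sigma> $ Some i = \<tau> $ Some i" for i
    using assms(2) by (simp add: slice_def vec_eq_iff poly_eq_iff flip: wpoly_eq_iff)
  then show ?thesis
    using assms(1) by (simp add: vec_eq_iff split_option_all)
qed

lemma homogeneous_der_lift: "homogeneous_der k r \<Longrightarrow> homogeneous_der k (lift_der r)"
  by (simp add: homogeneous_der_def split_option_all lift_der_nth homogeneous_zero homogeneous_incl)

text \<open>Without a \<open>w\<close>-component a factor \<open>w\<close> cancels from the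
  equation. As the partial derivatives of \<open>g\<close> do not involve \<open>w\<close>, one
  equation over R remains for each power of \<open>w\<close>.\<close>

lemma D0_cone_slice_iff:
  assumes "\<tau> $ None = 0"
  shows "\<tau> \<in> D0 (cone_poly g) \<longleftrightarrow> (\<forall>k. slice k \<tau> \<in> D0 g)"
proof -
  have "\<tau> \<in> D0 (cone_poly g) \<longleftrightarrow> (\<Sum>i\<in>UNIV. \<tau> $ Some i * incl (partial_deriv i g)) = 0"
    using assms by (simp add: D0_cone_iff indet_None_mult_eq_0_iff)
  also have "\<dots> \<longleftrightarrow> (\<forall>k. poly.coeff (wpoly (\<Sum>i\<in>UNIV. \<tau> $ Some i * incl (partial_deriv i g))) k = 0)"
    by (simp add: poly_eq_iff flip: wpoly_eq_0_iff)
  also have "\<dots> \<longleftrightarrow> (\<forall>k. slice k \<tau> \<in> D0 g)"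
    by (simp add: wpoly.hom_sum coeff_sum coeff_wpoly_incl_mult D0_def slice_def)
  finally show ?thesis .
qed

lemma lift_der_in_D0: "r \<in> D0 g \<Longrightarrow> lift_der r \<in> D0 (cone_poly g)"
  using slice_smult_lift[of _ 1 r]
  by (simp add: D0_cone_slice_iff lift_der_nth)
    (simp add: vmod.subspace_scale[OF subspace_D0])

lemma sum_lift_slices:
  assumes "\<tau> $ None = 0"
  obtains N where "\<tau> = (\<Sum>k<N. indet None ^ k *s lift_der (slice k \<tau>))"
proof -
  \<comment> \<open>Strictly above all degrees in \<open>w\<close>, so the slices from
    \<open>N\<close> on vanish.\<close>
  define N where "N = Suc (Max (range (\<lambda>i. degree (wpoly (\<tau> $ Some i)))))"
  have deg: "degree (wpoly (\<tau> $ Some i)) < N" for i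
    unfolding N_def less_Suc_eq_le by (rule Max_ge) auto
  have wpow: "wpoly (indet None ^ k) = monom 1 k" for k
    by (simp add: wpoly.hom_power wpoly_indet monom_altdef)
  have "\<tau> = (\<Sum>k<N. indet None ^ k *s lift_der (slice k \<tau>))"
  proof (rule slice_eqI)
    fix j
    have "slice j \<tau> = 0" if "\<not> j < N"
    proof -
      have "degree (wpoly (\<tau> $ Some i)) < j" for i
        using deg[of i] that by linarith
      then show ?thesis
        by (simp add: slice_def vec_eq_iff coeff_eq_0)
    qed
    moreover have "poly.coeff (wpoly (indet None ^ k)) j *s slice k \<tau> = (if k = j then slice k \<tau> else 0)" for k
      by (simp add: wpow)
    then have "slice j (\<Sum>k<N. indet None ^ k *s lift_der (slice k \<tau>))
        = (\<Sum>k<N. if k = j then slice k \<tau> else 0)"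
      by (simp only: slice_sum slice_smult_lift)
    ultimately show "slice j \<tau> = slice j (\<Sum>k<N. indet None ^ k *s lift_der (slice k \<tau>))"
      by simp
  qed (simp add: assms lift_der_nth)
  then show thesis by (rule that)
qed

section \<open>The derivation rho_0 and the generators of D0(f)\<close>

lemma rho0_nth: "rho0 d $ None = - (of_nat (d - 1) * indet None)" "rho0 d $ Some k = indet (Some k)"
  by (simp_all add: rho0_def)

lemma rho0_in_D0:
  assumes "homogeneous (int (d - 1)) (g :: 'v::finite mpol)"
  shows "rho0 d \<in> D0 (cone_poly g)"
proof -
  have "(\<Sum>i\<in>UNIV. indet (Some i) * incl (partial_deriv i g)) = of_nat (d - 1) * incl g"
    using arg_cong[OF euler_formula[OF assms], of incl]
    by (simp add: incl.hom_sum incl.hom_mult incl_indet incl.hom_of_nat)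
  then show ?thesis
    by (simp add: D0_cone_iff rho0_nth algebra_simps)
qed

lemma homogeneous_der_rho0: "homogeneous_der 1 (rho0 d)"
  using homogeneous_mult[OF homogeneous_of_nat[of "d - 1"] homogeneous_indet[of "None :: 'a option"]]
  by (simp add: homogeneous_der_def split_option_all rho0_nth homogeneous_indet homogeneous_uminus)

text \<open>Lifted derivations have \<open>w\<close>-component 0, so a coefficient of
  \<open>rho0\<close> in a relation can be detected in that component.\<close>

lemma smult_rho0_None_eq_0_iff:
  assumes "d \<ge> 2"
  shows "s * (rho0 d $ None) = 0 \<longleftrightarrow> s = 0"
proof
  assume "s * (rho0 d $ None) = 0"
  then have eq: "of_nat (d - 1) * (indet None * s) = 0"
    by (simp add: rho0_nth ac_simps)
  have "Poly_Mapping.single 0 (1 / of_nat (d - 1)) * of_nat (d - 1) = (1 :: 'a option mpol)"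
    using assms by (simp add: mult_single flip: single_of_nat)
  then have "indet None * s
      = Poly_Mapping.single 0 (1 / of_nat (d - 1)) * (of_nat (d - 1) * (indet None * s))"
    by (simp only: mult_1_left flip: mult.assoc)
  then show "s = 0"
    by (simp only: eq mult_zero_right indet_None_mult_eq_0_iff)
qed simp

lemma D0_cone_subtract_rho0:
  fixes g :: "('v::{finite,linorder}) mpol"
  assumes "d \<ge> 2" "g \<noteq> 0" and \<delta>: "\<delta> \<in> D0 (cone_poly g)"
  obtains b where "(\<delta> - b *s rho0 d) $ None = 0"
proof -
  define n :: complex where "n = of_nat (d - 1)"
  have n: "n \<noteq> 0"
    using assms by (simp add: n_def)
  \<comment> \<open>At \<open>w = 0\<close> the equation reduces to the value of
    \<open>\<delta> $ None\<close> there times \<open>g\<close>. As \<open>g\<close> is nonzero,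
    \<open>w\<close> divides \<open>\<delta> $ None\<close>.\<close>
  have "poly.coeff (wpoly (\<delta> $ None * incl g + indet None * (\<Sum>i\<in>UNIV. \<delta> $ Some i * incl (partial_deriv i g)))) 0 = 0"
    using \<delta> by (simp add: D0_cone_iff wpoly.hom_zero)
  then have "poly.coeff (wpoly (\<delta> $ None)) 0 = 0"
    using \<open>g \<noteq> 0\<close> by (simp add: wpoly.hom_add coeff_wpoly_incl_mult wpoly_indet_None_mult)
  then obtain q where q: "wpoly (\<delta> $ None) = pCons 0 q"
    by (metis coeff_pCons_0 pCons_cases)
  \<comment> \<open>The quotient of \<open>\<delta> $ None\<close> by \<open>w\<close>; dividing it
    further by the constant \<open>-(d - 1)\<close> gives the multiple of \<open>rho0\<close> to
    subtract.\<close>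
  define \<beta> where "\<beta> = poly (map_poly incl q) (indet None)"
  have "\<delta> $ None = indet None * \<beta>"
    using poly_wpoly[of "\<delta> $ None"]
    by (simp add: q \<beta>_def poly_map_poly_pCons[OF cring_hom_incl] incl.hom_zero)
  moreover have inv: "Poly_Mapping.single 0 (- 1 / n) * of_nat (d - 1) = (- 1 :: 'v option mpol)"
    using n by (simp add: mult_single single_uminus n_def flip: single_of_nat)
  have "Poly_Mapping.single 0 (- 1 / n) * \<beta> * - (of_nat (d - 1) * indet None)
      = - (Poly_Mapping.single 0 (- 1 / n) * of_nat (d - 1)) * (indet None * \<beta>)"
    by (simp add: ac_simps)
  then have "Poly_Mapping.single 0 (- 1 / n) * \<beta> * - (of_nat (d - 1) * indet None) = indet None * \<beta>"
    by (simp only: inv) simp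
  ultimately have "(\<delta> - (Poly_Mapping.single 0 (- 1 / n) * \<beta>) *s rho0 d) $ None = 0"
    by (simp add: rho0_nth)
  then show thesis by (rule that)
qed

lemma span_rhos:
  fixes g :: "('v::{finite,linorder}) mpol"
  assumes d: "d \<ge> 2" and g: "homogeneous (int (d - 1)) g" "g \<noteq> 0"
    and rs: "vmod.span (set rs) = D0 g"
  shows "vmod.span (set (rhos d rs)) = D0 (cone_poly g)"
proof
  have "set rs \<subseteq> D0 g"
    using rs vmod.span_superset by blast
  then have "set (rhos d rs) \<subseteq> D0 (cone_poly g)"
    using rho0_in_D0[OF g(1)] lift_der_in_D0 by (auto simp: rhos_def)
  then show "vmod.span (set (rhos d rs)) \<subseteq> D0 (cone_poly g)"
    by (intro vmod.span_minimal subspace_D0)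
  have lift: "lift_der r \<in> vmod.span (set (rhos d rs))" if r: "r \<in> D0 g" for r
  proof -
    obtain u where u: "r = (\<Sum>i<length rs. u i *s rs ! i)"
      using span_set_iff[of r rs] r rs by auto
    have "lift_der r = (\<Sum>i<length rs. incl (u i) *s lift_der (rs ! i))"
      by (simp add: u vec_eq_iff split_option_all lift_der_nth incl.hom_sum incl.hom_mult)
    moreover have "lift_der (rs ! i) \<in> set (rhos d rs)" if "i < length rs" for i
      using that by (simp add: rhos_def)
    ultimately show ?thesis
      by (auto intro!: vmod.span_sum vmod.span_scale intro: vmod.span_base)
  qed
  show "D0 (cone_poly g) \<subseteq> vmod.span (set (rhos d rs))"
  proof
    fix \<delta>
    assume \<delta>: "\<delta> \<in> D0 (cone_poly g)"
    obtain b where b: "(\<delta> - b *s rho0 d) $ None = 0"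
      using D0_cone_subtract_rho0[OF d g(2) \<delta>] by blast
    define \<tau> where "\<tau> = \<delta> - b *s rho0 d"
    have "\<tau> \<in> D0 (cone_poly g)"
      unfolding \<tau>_def
      by (intro vmod.subspace_diff vmod.subspace_scale subspace_D0 \<delta> rho0_in_D0 g(1))
    then have slices: "slice k \<tau> \<in> D0 g" for k
      using b D0_cone_slice_iff[of \<tau> g] by (simp add: \<tau>_def)
    obtain N where "\<tau> = (\<Sum>k<N. indet None ^ k *s lift_der (slice k \<tau>))"
      using sum_lift_slices[of \<tau>] b by (auto simp: \<tau>_def)
    then have "\<tau> \<in> vmod.span (set (rhos d rs))"
      using lift[OF slices] by (metis (no_types, lifting) vmod.span_sum vmod.span_scale)
    moreover have "b *s rho0 d \<in> vmod.span (set (rhos d rs))"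
      by (intro vmod.span_scale vmod.span_base) (simp add: rhos_def)
    ultimately have "\<tau> + b *s rho0 d \<in> vmod.span (set (rhos d rs))"
      by (rule vmod.span_add)
    then show "\<delta> \<in> vmod.span (set (rhos d rs))"
      by (simp add: \<tau>_def)
  qed
qed

text \<open>The \<open>w\<close>-component forces the coefficient of \<open>rho0\<close> to vanish.
  The other generators have entries in R, so the rest splits into one relation over R for each power
  of \<open>w\<close>.\<close>

lemma relations_rhos_iff:
  assumes "d \<ge> 2"
  shows "u \<in> relations (rhos d rs) \<longleftrightarrow>
    u \<in> free_mod (Suc (length rs)) \<and> u 0 = 0 \<and>
    (\<forall>k. (\<lambda>i. poly.coeff (wpoly (u (Suc i))) k) \<in> relations rs)"
proof -
  define \<sigma> where "\<sigma> = (\<Sum>i<length rs. u (Suc i) *s lift_der (rs ! i))"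
  have sum: "(\<Sum>i<length (rhos d rs). u i *s rhos d rs ! i) = u 0 *s rho0 d + \<sigma>"
    by (simp add: rhos_def sum.lessThan_Suc_shift \<sigma>_def del: sum.lessThan_Suc)
  have \<sigma>0: "\<sigma> $ None = 0"
    by (simp add: \<sigma>_def lift_der_nth)
  have slice: "slice k \<sigma> = (\<Sum>i<length rs. poly.coeff (wpoly (u (Suc i))) k *s rs ! i)" for k
    by (simp add: \<sigma>_def slice_sum slice_smult_lift)
  have "u 0 *s rho0 d + \<sigma> = 0 \<longleftrightarrow> u 0 = 0 \<and> \<sigma> = 0"
  proof
    assume eq: "u 0 *s rho0 d + \<sigma> = 0"
    then have "(u 0 *s rho0 d + \<sigma>) $ None = 0"
      by simp
    then have "u 0 * rho0 d $ None = 0"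
      using \<sigma>0 by simp
    then have "u 0 = 0"
      by (rule iffD1[OF smult_rho0_None_eq_0_iff[OF assms]])
    then show "u 0 = 0 \<and> \<sigma> = 0"
      using eq by simp
  qed simp
  moreover have "\<sigma> = 0 \<longleftrightarrow> (\<forall>k. slice k \<sigma> = 0)"
    using slice_eqI[of \<sigma> 0] \<sigma>0 by (auto simp: slice_zero)
  ultimately have eq0: "u 0 *s rho0 d + \<sigma> = 0 \<longleftrightarrow> u 0 = 0 \<and>
      (\<forall>k. (\<Sum>i<length rs. poly.coeff (wpoly (u (Suc i))) k *s rs ! i) = 0)"
    by (simp add: slice)
  have free: "(\<lambda>i. poly.coeff (wpoly (u (Suc i))) k) \<in> free_mod (length rs)"
    if "u \<in> free_mod (Suc (length rs))" for k
    using that by (simp add: free_mod_def wpoly.hom_zero)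
  show ?thesis
    unfolding relations_def mem_Collect_eq sum eq0
    using free by (auto simp: rhos_def)
qed

section \<open>Syzygies of minimal degree are primitive\<close>

text \<open>Writing \<open>p / q = p' / q'\<close> in lowest terms, in a form that transfers along isomorphisms.\<close>

lemma lowest_terms:
  fixes p q :: "'a::factorial_ring_gcd"
  assumes "q \<noteq> 0"
  shows "\<exists>c p' q'. p = c * p' \<and> q = c * q' \<and> (\<forall>x. q' dvd p' * x \<longrightarrow> q' dvd x)"
proof -
  have "coprime (q div gcd p q) (p div gcd p q)"
    using assms by (simp add: div_gcd_coprime coprime_commute)
  then have "\<forall>x. q div gcd p q dvd p div gcd p q * x \<longrightarrow> q div gcd p q dvd x"
    using coprime_dvd_mult_right_iff by blast
  moreover have "p = gcd p q * (p div gcd p q)" "q = gcd p q * (q div gcd p q)"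
    by simp_all
  ultimately show ?thesis by blast
qed

lemma mpol_3_iso:
  obtains \<phi> :: "3 mpol \<Rightarrow> complex poly poly poly" and \<psi> where
    "cring_hom \<phi>" "cring_hom \<psi>" "\<And>p. \<psi> (\<phi> p) = p" "\<And>q. \<phi> (\<psi> q) = q"
proof -
  define X :: "3 \<Rightarrow> complex poly poly poly" where
    \<comment> \<open>Variable 1 becomes the outermost indeterminate and variable 3 the innermost;
      accordingly \<open>\<psi>1\<close>, \<open>\<psi>2\<close> and \<open>\<psi>\<close> evaluate
      one more layer each.\<close>
    "X i = (if i = 1 then [:0, 1:] else if i = 2 then [:[:0, 1:]:] else [:[:[:0, 1:]:]:])" for i
  define \<phi> where "\<phi> = msubst (\<lambda>a. [:[:[:a:]:]:]) X"
  define \<psi>1 :: "complex poly \<Rightarrow> 3 mpol" where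
    "\<psi>1 q = poly (map_poly (Poly_Mapping.single 0) q) (indet 3)" for q
  define \<psi>2 where "\<psi>2 q = poly (map_poly \<psi>1 q) (indet 2)" for q
  define \<psi> where "\<psi> q = poly (map_poly \<psi>2 q) (indet 1)" for q
  have c: "cring_hom (\<lambda>a :: complex. [:[:[:a:]:]:])"
    by unfold_locales (simp_all add: one_pCons)
  have \<psi>1: "cring_hom \<psi>1"
    unfolding \<psi>1_def[abs_def] by (rule cring_hom_poly_eval[OF cring_hom_const_mpol])
  have \<psi>2: "cring_hom \<psi>2"
    unfolding \<psi>2_def[abs_def] by (rule cring_hom_poly_eval[OF \<psi>1])
  have \<psi>: "cring_hom \<psi>"
    unfolding \<psi>_def[abs_def] by (rule cring_hom_poly_eval[OF \<psi>2])
  have \<phi>: "cring_hom \<phi>"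
    unfolding \<phi>_def by (rule cring_hom_msubst[OF c])
  have \<phi>_const: "\<phi> (Poly_Mapping.single 0 a) = [:[:[:a:]:]:]" for a
    by (simp add: \<phi>_def msubst_const[OF c])
  have \<phi>_indet: "\<phi> (indet i) = X i" for i
    by (simp add: \<phi>_def msubst_indet[OF c])
  have \<psi>1_simps: "\<psi>1 [:a:] = Poly_Mapping.single 0 a" "\<psi>1 [:0, 1:] = indet 3" for a
    by (simp_all add: \<psi>1_def poly_map_poly_const[OF cring_hom_const_mpol]
        poly_map_poly_X[OF cring_hom_const_mpol])
  have \<psi>2_simps: "\<psi>2 [:q:] = \<psi>1 q" "\<psi>2 [:0, 1:] = indet 2" for q
    by (simp_all add: \<psi>2_def poly_map_poly_const[OF \<psi>1] poly_map_poly_X[OF \<psi>1])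
  have \<psi>_simps: "\<psi> [:q:] = \<psi>2 q" "\<psi> [:0, 1:] = indet 1" for q
    by (simp_all add: \<psi>_def poly_map_poly_const[OF \<psi>2] poly_map_poly_X[OF \<psi>2])
  have idx: "(2 :: 3) \<noteq> 1" "(3 :: 3) \<noteq> 1" "(3 :: 3) \<noteq> 2"
    by simp_all
  have \<psi>\<phi>: "\<psi> (\<phi> p) = p" for p
  proof (rule cring_hom_mpol_ext[OF cring_hom_comp[OF \<psi> \<phi>] cring_hom_id])
    show "\<psi> (\<phi> (indet i)) = indet i" for i
      using exhaust_3[of i] idx by (auto simp: \<phi>_indet X_def \<psi>_simps \<psi>2_simps \<psi>1_simps)
  qed (simp add: \<phi>_const \<psi>_simps \<psi>2_simps \<psi>1_simps)
  have cc: "cring_hom (\<lambda>q :: complex poly. [:[:q:]:])"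
    by unfold_locales (simp_all add: one_pCons)
  \<comment> \<open>That \<open>\<phi>\<close> inverts the evaluations is shown layer by layer, from
    the innermost ring outwards.\<close>
  have 1: "\<phi> (\<psi>1 q) = [:[:q:]:]" for q
    by (rule cring_hom_poly_ext[OF cring_hom_comp[OF \<phi> \<psi>1] cc])
      (simp_all add: \<psi>1_simps \<phi>_const \<phi>_indet X_def idx)
  have 2: "\<phi> (\<psi>2 q) = [:q:]" for q
    by (rule cring_hom_poly_ext[OF cring_hom_comp[OF \<phi> \<psi>2] cring_hom_const_poly])
      (simp_all add: \<psi>2_simps 1 \<phi>_indet X_def idx)
  have "\<phi> (\<psi> q) = q" for q
    by (rule cring_hom_poly_ext[OF cring_hom_comp[OF \<phi> \<psi>] cring_hom_id])
      (simp_all add: \<psi>_simps 2 \<phi>_indet X_def)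
  then show thesis
    using that \<phi> \<psi> \<psi>\<phi> by blast
qed

lemma lowest_terms_mpol_3:
  fixes p q :: "3 mpol"
  assumes "q \<noteq> 0"
  obtains c p' q' where "p = c * p'" "q = c * q'" "\<And>x. q' dvd p' * x \<Longrightarrow> q' dvd x"
proof -
  obtain \<phi> :: "3 mpol \<Rightarrow> complex poly poly poly" and \<psi> where
    iso: "cring_hom \<phi>" "cring_hom \<psi>" "\<And>p. \<psi> (\<phi> p) = p" "\<And>q. \<phi> (\<psi> q) = q"
    using mpol_3_iso by blast
  interpret f: cring_hom \<phi> by fact
  interpret g: cring_hom \<psi> by fact
  have "\<phi> q \<noteq> 0"
    using assms iso(3)[of q] g.hom_zero by force
  then obtain c p' q' where eq: "\<phi> p = c * p'" "\<phi> q = c * q'"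
    and dvd: "\<And>x. q' dvd p' * x \<Longrightarrow> q' dvd x"
    using lowest_terms by metis
  show thesis
  proof
    show "p = \<psi> c * \<psi> p'" "q = \<psi> c * \<psi> q'"
      using arg_cong[OF eq(1), of \<psi>] arg_cong[OF eq(2), of \<psi>] by (simp_all add: iso g.hom_mult)
    fix x
    assume "\<psi> q' dvd \<psi> p' * x"
    then obtain y where "\<psi> p' * x = \<psi> q' * y" ..
    then have "\<phi> (\<psi> p' * x) = \<phi> (\<psi> q' * y)" by simp
    then have "q' dvd p' * \<phi> x"
      by (simp add: f.hom_mult iso)
    then obtain z where "\<phi> x = q' * z"
      using dvd by blast
    then have "\<psi> (\<phi> x) = \<psi> (q' * z)" by simp
    then show "\<psi> q' dvd x"
      by (simp add: g.hom_mult iso)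
  qed
qed

text \<open>The substitution \<open>x\<^sub>i \<mapsto> x\<^sub>i T\<close>, whose coefficients are the homogeneous components.\<close>

definition tpoly :: "('v::finite) mpol \<Rightarrow> 'v mpol poly" where
  "tpoly = msubst (\<lambda>a. [:Poly_Mapping.single 0 a:]) (\<lambda>i. [:0, indet i:])"

lemma cring_hom_tpoly: "cring_hom tpoly"
  unfolding tpoly_def by (rule cring_hom_msubst[OF cring_hom_const_mpol_poly])

interpretation tpoly: cring_hom tpoly
  by (rule cring_hom_tpoly)

lemma prod_monom: "finite A \<Longrightarrow> (\<Prod>i\<in>A. monom (f i) (n i)) = monom (\<Prod>i\<in>A. f i) (\<Sum>i\<in>A. n i)"
  by (induction A rule: finite_induct) (simp_all add: mult_monom one_pCons monom_0)

text \<open>Hence \<open>degree (tpoly p)\<close> is the total degree of a nonzero \<open>p\<close>,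
  and its additivity on products is that of univariate polynomials over an integral domain.\<close>

lemma coeff_tpoly: "poly.coeff (tpoly p) k = hcomp (int k) p"
proof (induction p rule: poly_mapping_single_add_induct)
  case (single t a)
  have X: "[:0, indet i:] = monom (indet i) 1" for i :: 'a
    by (simp add: monom_altdef)
  have "tpoly (Poly_Mapping.single t a)
      = monom (Poly_Mapping.single 0 a * (\<Prod>i\<in>UNIV. indet i ^ Poly_Mapping.lookup t i))
          (\<Sum>i\<in>UNIV. Poly_Mapping.lookup t i)"
    by (simp add: tpoly_def msubst_single[OF cring_hom_const_mpol_poly] X monom_power prod_monom
        smult_monom del: One_nat_def)
  also have "\<dots> = monom (Poly_Mapping.single t a) (mono_degree t)"
    by (simp only: single_eq_prod_indet[of t a, symmetric] mono_degree_eq_sum)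
  finally show ?case
    by (simp add: hcomp_single)
qed (simp add: tpoly.hom_add hcomp_add)

lemma tpoly_homogeneous: "homogeneous (int n) p \<Longrightarrow> tpoly p = monom p n"
  by (rule poly_eqI) (simp add: coeff_tpoly hcomp_homogeneous)

lemma tpoly_eq_0_iff: "tpoly p = 0 \<longleftrightarrow> p = 0"
proof
  assume "tpoly p = 0"
  then have "hcomp (int k) p = 0" for k
    by (simp flip: coeff_tpoly)
  then have "Poly_Mapping.lookup (hcomp (int (mono_degree t)) p) t = 0" for t
    by simp
  then show "p = 0"
    by (intro poly_mapping_eqI) (simp add: lookup_hcomp)
qed (simp add: tpoly.hom_zero)

lemma tpoly_degree_0:
  assumes "degree (tpoly p) = 0"
  obtains c where "p = Poly_Mapping.single 0 c"
proof -
  have zero: "hcomp (int k) p = 0" if "k \<noteq> 0" for k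
    using assms that by (simp add: coeff_eq_0 flip: coeff_tpoly)
  have "Poly_Mapping.lookup (hcomp (int (mono_degree t)) p) t = 0" if "t \<noteq> 0" for t
  proof -
    have "mono_degree t \<noteq> 0"
      using that by (simp add: mono_degree_eq_0_iff)
    then show ?thesis by (simp add: zero)
  qed
  then have "p = Poly_Mapping.single 0 (const_term p)"
    by (intro poly_mapping_eqI) (auto simp: lookup_hcomp lookup_single when_def)
  then show thesis by (rule that)
qed

text \<open>All partial derivatives of \<open>g\<close> are homogeneous of degree
  \<open>n - 1\<close>, so the defining equation splits by degree.\<close>

lemma D0_hcomp:
  assumes g: "homogeneous n (g :: 'v::finite mpol)" and \<alpha>: "\<alpha> \<in> D0 g"
  shows "(\<chi> i. hcomp k (\<alpha> $ i)) \<in> D0 g"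
proof -
  have "hcomp (k + (n - 1)) (\<Sum>i\<in>UNIV. \<alpha> $ i * partial_deriv i g)
      = (\<Sum>i\<in>UNIV. hcomp k (\<alpha> $ i) * partial_deriv i g)"
    by (simp add: hcomp_sum hcomp_mult_homogeneous[OF homogeneous_partial_deriv[OF g]])
  then show ?thesis
    using \<alpha> by (simp add: D0_def hcomp_zero)
qed

text \<open>
  A common factor \<open>q\<close> of the entries of \<open>\<alpha>\<close> could be divided out, giving a syzygy whose
  components of degree below \<open>e\<close> vanish by minimality; hence \<open>q\<close> is a constant. As the ring is
  factorial, every vector parallel to \<open>\<alpha>\<close> is then a multiple of \<open>\<alpha>\<close>.
\<close>

lemma minimal_syzygy_primitive:
  fixes g :: "3 mpol"
  assumes g: "homogeneous n g" and \<alpha>: "\<alpha> \<in> D0 g" "\<alpha> \<noteq> 0" "homogeneous_der (int e) \<alpha>"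
    and min: "\<And>k \<beta>. \<beta> \<in> D0 g \<Longrightarrow> \<beta> \<noteq> 0 \<Longrightarrow> homogeneous_der k \<beta> \<Longrightarrow> int e \<le> k"
    and parallel: "\<And>i j. v $ i * \<alpha> $ j = v $ j * \<alpha> $ i"
  obtains b where "v = b *s \<alpha>"
proof -
  obtain l where l: "\<alpha> $ l \<noteq> 0"
    using \<alpha>(2) by (auto simp: vec_eq_iff)
  obtain c p q where cpq: "v $ l = c * p" "\<alpha> $ l = c * q" and dvd: "\<And>x. q dvd p * x \<Longrightarrow> q dvd x"
    using lowest_terms_mpol_3[OF l, of "v $ l"] by blast
  have cq: "c \<noteq> 0" "q \<noteq> 0"
    using l cpq by auto
  \<comment> \<open>Over the fraction field, \<open>v\<close> is \<open>p / q\<close> times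
    \<open>\<alpha>\<close>.\<close>
  have cross: "q * v $ j = p * \<alpha> $ j" for j
  proof -
    have "c * (p * \<alpha> $ j) = c * (q * v $ j)"
      using parallel[of l j] cpq by (simp add: ac_simps)
    then show ?thesis
      using cq by simp
  qed
  have "q dvd \<alpha> $ j" for j
    using dvd[of "\<alpha> $ j"] dvd_triv_left[of q "v $ j"] by (simp add: cross)
  then have "\<exists>\<beta>. \<forall>j. \<alpha> $ j = q * \<beta> j"
    unfolding dvd_def by (intro choice) blast
  then obtain \<beta> where \<beta>: "\<And>j. \<alpha> $ j = q * \<beta> j"
    by blast
  have v: "v $ j = p * \<beta> j" for j
    using cross[of j] cq by (simp add: \<beta> mult.left_commute)
  have "q * (\<Sum>i\<in>UNIV. \<beta> i * partial_deriv i g) = 0"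
    using \<alpha>(1) by (simp add: D0_def \<beta> sum_distrib_left mult.assoc)
  then have "(\<chi> i. \<beta> i) \<in> D0 g"
    using cq by (simp add: D0_def)
  then have comp: "(\<chi> i. hcomp k (\<beta> i)) \<in> D0 g" for k
    using D0_hcomp[OF g, of "\<chi> i. \<beta> i" k] by simp
  \<comment> \<open>\<open>\<beta>\<close> is not yet known to be homogeneous, but its components
    are syzygies too, and minimality applies to each of them.\<close>
  have low: "hcomp k (\<beta> i) = 0" if "k < int e" for i k
  proof (rule ccontr)
    assume "hcomp k (\<beta> i) \<noteq> 0"
    then have "(\<chi> i. hcomp k (\<beta> i)) \<noteq> 0"
      by (auto simp: vec_eq_iff)
    then have "int e \<le> k"
      using min[OF comp] by (simp add: homogeneous_der_def homogeneous_hcomp)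
    then show False
      using that by simp
  qed
  have \<beta>l: "\<beta> l \<noteq> 0"
    using l \<beta>[of l] by auto
  \<comment> \<open>In \<open>\<alpha> $ l = q * \<beta> l\<close> the total degrees add up to
    \<open>e\<close>, while \<open>\<beta> l\<close> alone has degree at least \<open>e\<close>;
    nothing is left for \<open>q\<close>.\<close>
  have "tpoly q * tpoly (\<beta> l) = monom (\<alpha> $ l) e"
    using tpoly_homogeneous[of e "\<alpha> $ l"] \<alpha>(3) by (simp add: homogeneous_der_def \<beta> tpoly.hom_mult)
  then have "degree (tpoly q) + degree (tpoly (\<beta> l)) = e"
    using l cq \<beta>l by (metis degree_monom_eq degree_mult_eq tpoly_eq_0_iff)
  moreover have "hcomp (int (degree (tpoly (\<beta> l)))) (\<beta> l) \<noteq> 0"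
    using \<beta>l tpoly_eq_0_iff[of "\<beta> l"] by (simp flip: coeff_tpoly)
  then have "e \<le> degree (tpoly (\<beta> l))"
    using low[of "int (degree (tpoly (\<beta> l)))" l] by fastforce
  ultimately have "degree (tpoly q) = 0"
    by simp
  then obtain a where a: "q = Poly_Mapping.single 0 a"
    by (rule tpoly_degree_0)
  have "Poly_Mapping.single 0 (1 / a) * (q * x) = x" for x
    using cq by (auto simp: a mult_single simp flip: mult.assoc)
  then have "v $ j = (p * Poly_Mapping.single 0 (1 / a)) * \<alpha> $ j" for j
    by (simp add: v \<beta> mult.assoc)
  then have "v = (p * Poly_Mapping.single 0 (1 / a)) *s \<alpha>"
    by (simp add: vec_eq_iff)
  then show thesis by (rule that)
qed

section \<open>Transfer between the curve and its cone\<close>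

text \<open>Converse of \<open>minimal_relationsI\<close>: expressing one generator through the
  others is a relation with the constant -1 as a coefficient.\<close>

lemma minimal_relations_irredundant:
  fixes \<delta>s :: "('v::finite) derivation list"
  assumes "minimal_relations \<delta>s" and i: "i < length \<delta>s"
  shows "\<delta>s ! i \<notin> vmod.span {\<delta>s ! j | j. j < length \<delta>s \<and> j \<noteq> i}"
proof
  assume "\<delta>s ! i \<in> vmod.span {\<delta>s ! j | j. j < length \<delta>s \<and> j \<noteq> i}"
  moreover have "{\<delta>s ! j | j. j < length \<delta>s \<and> j \<noteq> i} = (!) \<delta>s ` ({..<length \<delta>s} - {i})"
    by auto
  ultimately have "\<exists>u. \<delta>s ! i = (\<Sum>j\<in>{..<length \<delta>s} - {i}. u j *s \<delta>s ! j)"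
    using span_image_iff[of "{..<length \<delta>s} - {i}" "\<delta>s ! i" "(!) \<delta>s"] by simp
  then obtain u where u: "\<delta>s ! i = (\<Sum>j\<in>{..<length \<delta>s} - {i}. u j *s \<delta>s ! j)" ..
  define w where "w j = (if j = i then - 1 else if j < length \<delta>s then u j else 0)" for j
  have "(\<Sum>j<length \<delta>s. w j *s \<delta>s ! j) = w i *s \<delta>s ! i + (\<Sum>j\<in>{..<length \<delta>s} - {i}. w j *s \<delta>s ! j)"
    using i by (simp add: sum.remove[of _ i])
  also have "(\<Sum>j\<in>{..<length \<delta>s} - {i}. w j *s \<delta>s ! j) = \<delta>s ! i"
    unfolding u by (rule sum.cong) (auto simp: w_def)
  finally have "w \<in> relations \<delta>s"
    using i by (simp add: relations_def free_mod_def w_def)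
  then have "const_term (w i) = 0"
    using assms(1) by (simp add: minimal_relations_def)
  then show False
    by (simp add: w_def)
qed

lemma minimal_generators_iff:
  "minimal_generators h es \<delta>s \<longleftrightarrow>
    graded_list es \<delta>s \<and> sorted es \<and> vmod.span (set \<delta>s) = D0 h \<and> minimal_relations \<delta>s"
proof
  assume "minimal_generators h es \<delta>s"
  then show "graded_list es \<delta>s \<and> sorted es \<and> vmod.span (set \<delta>s) = D0 h \<and> minimal_relations \<delta>s"
    using minimal_generatorsD[of h es \<delta>s] by (simp add: minimal_generators_def)
next
  assume r: "graded_list es \<delta>s \<and> sorted es \<and> vmod.span (set \<delta>s) = D0 h \<and> minimal_relations \<delta>s"
  then have "set \<delta>s \<subseteq> D0 h"
    using vmod.span_superset by blast
  then show "minimal_generators h es \<delta>s"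
    using r minimal_relations_irredundant[of \<delta>s]
    by (auto simp: minimal_generators_def graded_list_def)
qed

section \<open>Degrees of minimal generators\<close>

lemma minimal_generators_nonzero:
  assumes "minimal_generators h es \<delta>s" "i < length \<delta>s"
  shows "\<delta>s ! i \<noteq> 0"
proof
  assume "\<delta>s ! i = 0"
  then have "\<delta>s ! i \<in> vmod.span {\<delta>s ! j | j. j < length \<delta>s \<and> j \<noteq> i}"
    by (simp add: vmod.span_zero)
  then show False
    using assms by (simp add: minimal_generators_def)
qed

lemma minimal_generators_degrees_unique:
  assumes "minimal_generators h es \<delta>s" "minimal_generators h es' \<delta>s'"
  shows "es = es'"
proof -
  have "mset es = mset es'"
    using minimal_degrees_unique[of es \<delta>s es' \<delta>s'] assms by (simp add: minimal_generators_iff)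
  then show ?thesis
    using assms by (metis minimal_generators_iff properties_for_sort)
qed

text \<open>In a degree below those of all generators, the coefficients of a combination would have
  negative degree and hence vanish.\<close>

lemma degree_ge:
  assumes gens: "minimal_generators h es \<delta>s" and b: "\<And>e. e \<in> set es \<Longrightarrow> b \<le> e"
    and \<alpha>: "\<alpha> \<in> D0 h" "\<alpha> \<noteq> 0" "homogeneous_der k \<alpha>"
  shows "b \<le> k"
proof (rule ccontr)
  assume "\<not> b \<le> k"
  obtain u where u: "\<alpha> = (\<Sum>i<length \<delta>s. u i *s \<delta>s ! i)"
    using \<alpha>(1) span_set_iff[of \<alpha> \<delta>s] minimal_generatorsD(3)[OF gens] by auto
  have "k - es ! i < 0" if "i < length \<delta>s" for i
    using b[of "es ! i"] that gens \<open>\<not> b \<le> k\<close> by (simp add: minimal_generators_def)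
  then have "hcomp (k - es ! i) (u i) = 0" if "i < length \<delta>s" for i
    using that homogeneous_hcomp homogeneous_neg_eq_0 by blast
  then have "(\<chi> l. hcomp k (\<alpha> $ l)) = 0"
    using hcomp_combination[OF minimal_generatorsD(1)[OF gens], of k u] by (simp add: u)
  then show False
    using \<alpha>(2,3) by (simp add: vec_eq_iff homogeneous_der_def homogeneous_iff_hcomp)
qed

lemma degree_ge_1:
  assumes "mdr h > 0" and \<alpha>: "\<alpha> \<in> D0 h" "\<alpha> \<noteq> 0" "homogeneous_der k \<alpha>"
  shows "1 \<le> k"
proof (rule ccontr)
  assume "\<not> 1 \<le> k"
  moreover have "\<not> k < 0"
    using \<alpha>(2,3) homogeneous_neg_eq_0 by (auto simp: vec_eq_iff homogeneous_der_def)
  ultimately have "k = int 0"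
    by simp
  then have "mdr h \<le> 0"
    unfolding mdr_def using \<alpha> by (intro Least_le) blast
  then show False
    using assms(1) by simp
qed

lemma minimal_generators_degree_ge_1:
  assumes "mdr h > 0" "minimal_generators h es \<delta>s" "e \<in> set es"
  shows "1 \<le> e"
proof -
  obtain i where i: "i < length \<delta>s" "e = es ! i"
    using assms(2,3) by (auto simp: minimal_generators_def in_set_conv_nth)
  show ?thesis
    using degree_ge_1[OF assms(1), of "\<delta>s ! i" e] minimal_generators_nonzero[OF assms(2) i(1)] assms(2) i
    by (simp add: minimal_generators_def)
qed

section \<open>Minimal generators and minimal degree for the cone\<close>

lemma const_term_coeff_wpoly_0: "const_term (poly.coeff (wpoly s) 0) = const_term s"
  by (rule cring_hom_mpol_ext[OF cring_hom_comp[OF cring_hom_const_term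
          cring_hom_comp[OF cring_hom_coeff_0 cring_hom_wpoly]] cring_hom_const_term])
    (simp_all add: wpoly_const wpoly_indet const_term_indet split: option.split)

text \<open>Setting \<open>w = 0\<close> keeps constant terms and turns the relation into one among
  \<open>rs\<close>, where minimality is known.\<close>

lemma minimal_relations_rhos:
  assumes "d \<ge> 2" "minimal_relations rs"
  shows "minimal_relations (rhos d rs)"
  unfolding minimal_relations_def
proof (intro ballI allI)
  fix u i
  assume "u \<in> relations (rhos d rs)"
  then have u: "u 0 = 0" "(\<lambda>i. poly.coeff (wpoly (u (Suc i))) 0) \<in> relations rs"
    using relations_rhos_iff[OF assms(1)] by blast+
  show "const_term (u i) = 0"
  proof (cases i)
    case (Suc l)
    have "const_term (poly.coeff (wpoly (u (Suc l))) 0) = 0"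
      using bspec[OF assms(2)[unfolded minimal_relations_def] u(2)] by blast
    then show ?thesis
      by (simp add: Suc const_term_coeff_wpoly_0)
  qed (simp add: u)
qed

lemma graded_list_rhos: "graded_list es rs \<Longrightarrow> graded_list (1 # es) (rhos d rs)"
  by (auto simp: graded_list_def rhos_def nth_Cons homogeneous_der_rho0 homogeneous_der_lift
      split: nat.split)

lemma minimal_generators_rhos:
  fixes g :: "('v::{finite,linorder}) mpol"
  assumes "d \<ge> 2" "homogeneous (int (d - 1)) g" "g \<noteq> 0" "mdr g > 0" "minimal_generators g es rs"
  shows "minimal_generators (cone_poly g) (1 # es) (rhos d rs)"
  using assms minimal_generators_degree_ge_1[OF assms(4,5)]
  by (auto simp: minimal_generators_iff graded_list_rhos minimal_relations_rhos span_rhos)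

lemma mdr_cone_poly:
  fixes g :: "('v::{finite,linorder}) mpol"
  assumes "d \<ge> 2" "homogeneous (int (d - 1)) g" "g \<noteq> 0" "mdr g > 0" "minimal_generators g es rs"
  shows "mdr (cone_poly g) = 1"
  unfolding mdr_def
proof (rule Least_equality)
  have "rho0 d $ None \<noteq> (0 :: 'v option mpol)"
    using smult_rho0_None_eq_0_iff[OF assms(1), of 1] by simp
  then have "rho0 d \<noteq> (0 :: 'v option derivation)"
    by (auto simp: vec_eq_iff)
  then show "\<exists>\<alpha>\<in>D0 (cone_poly g). \<alpha> \<noteq> 0 \<and> homogeneous_der (int 1) \<alpha>"
    using rho0_in_D0[OF assms(2)] homogeneous_der_rho0[of d] by auto
next
  fix k
  assume "\<exists>\<alpha>\<in>D0 (cone_poly g). \<alpha> \<noteq> 0 \<and> homogeneous_der (int k) \<alpha>"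
  then obtain \<alpha> where \<alpha>: "\<alpha> \<in> D0 (cone_poly g)" "\<alpha> \<noteq> 0" "homogeneous_der (int k) \<alpha>"
    by blast
  have "1 \<le> int k"
    using minimal_generators_degree_ge_1[OF assms(4,5)]
    by (intro degree_ge[OF minimal_generators_rhos[OF assms] _ \<alpha>]) auto
  then show "1 \<le> k"
    by simp
qed

section \<open>Extending relations from R to R[w] and restricting them to w = 0\<close>

lemma sum_w_powers_eq:
  fixes s :: "('v::finite) option mpol"
  assumes "degree (wpoly s) \<le> N"
  shows "(\<Sum>k\<le>N. indet None ^ k * incl (poly.coeff (wpoly s) k)) = s"
proof -
  have "wpoly (indet None ^ k * incl a) = monom a k" for k and a :: "'v mpol"
    by (simp add: wpoly.hom_mult wpoly.hom_power wpoly_indet wpoly_incl monom_altdef mult.commute)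
  then have "wpoly (\<Sum>k\<le>N. indet None ^ k * incl (poly.coeff (wpoly s) k)) = wpoly s"
    using poly_as_sum_of_monoms'[OF assms] by (simp add: wpoly.hom_sum)
  then show ?thesis
    by (simp only: wpoly_eq_iff)
qed

text \<open>The leading 0 is the coefficient of \<open>rho0\<close>, which takes part in no
  relation.\<close>

definition lift_rel :: "(nat \<Rightarrow> ('v::finite) mpol) \<Rightarrow> nat \<Rightarrow> 'v option mpol" where
  "lift_rel u = case_nat 0 (\<lambda>i. incl (u i))"

lemma lift_rel_simps: "lift_rel u 0 = 0" "lift_rel u (Suc i) = incl (u i)"
  by (simp_all add: lift_rel_def)

lemma lift_rel_in_relations:
  assumes "d \<ge> 2" "u \<in> relations rs"
  shows "lift_rel u \<in> relations (rhos d rs)"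
proof -
  have "lift_rel u \<in> free_mod (Suc (length rs))"
    using assms(2)
    by (auto simp: relations_def free_mod_def lift_rel_def incl.hom_zero split: nat.split)
  moreover have "(\<lambda>i. poly.coeff (wpoly (lift_rel u (Suc i))) k) \<in> relations rs" for k
    using assms(2) relations_smult[OF assms(2), of 0]
    by (cases k) (simp_all add: lift_rel_simps wpoly_incl)
  ultimately show ?thesis
    using relations_rhos_iff[OF assms(1), of "lift_rel u" rs] by (simp add: lift_rel_simps)
qed

lemma relations_rhos_trivial_iff:
  assumes "d \<ge> 2"
  shows "relations (rhos d rs) = {\<lambda>_. 0} \<longleftrightarrow> relations rs = {\<lambda>_. 0}"
proof
  assume triv: "relations (rhos d rs) = {\<lambda>_. 0}"
  have "u i = 0" if "u \<in> relations rs" for u i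
  proof -
    have "lift_rel u (Suc i) = 0"
      using lift_rel_in_relations[OF assms that] triv by simp
    then show ?thesis
      by (simp add: lift_rel_simps incl_eq_0_iff)
  qed
  moreover have "(\<lambda>_. 0) \<in> relations rs"
    by (simp add: relations_def free_mod_def)
  ultimately show "relations rs = {\<lambda>_. 0}"
    by blast
next
  assume triv: "relations rs = {\<lambda>_. 0}"
  have "u i = 0" if "u \<in> relations (rhos d rs)" for u i
  proof (cases i)
    case (Suc l)
    have "(\<lambda>i. poly.coeff (wpoly (u (Suc i))) k) = (\<lambda>_. 0)" for k
      using that triv relations_rhos_iff[OF assms] by blast
    then have "wpoly (u i) = 0"
      by (simp add: poly_eq_iff fun_eq_iff Suc)
    then show ?thesis
      by (simp add: wpoly_eq_0_iff)
  qed (use that relations_rhos_iff[OF assms] in blast)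
  moreover have "(\<lambda>_. 0) \<in> relations (rhos d rs)"
    by (simp add: relations_def free_mod_def)
  ultimately show "relations (rhos d rs) = {\<lambda>_. 0}"
    by blast
qed

text \<open>For each power of \<open>w\<close>, the coefficients of a relation form a multiple
  \<open>a k\<close> of \<open>u\<close> over R. The required multiplier in S is the polynomial in
  \<open>w\<close> with coefficients \<open>a k\<close>.\<close>

lemma cyclic_relations_lift:
  assumes "d \<ge> 2" and u: "relations rs = {(\<lambda>i. a * u i) | a. True}"
  shows "relations (rhos d rs) = {(\<lambda>i. a * lift_rel u i) | a. True}"
proof -
  have "\<exists>a. v = (\<lambda>i. a * lift_rel u i)" if v: "v \<in> relations (rhos d rs)" for v
  proof -
    have "\<forall>k. \<exists>a. (\<lambda>i. poly.coeff (wpoly (v (Suc i))) k) = (\<lambda>i. a * u i)"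
      using v u relations_rhos_iff[OF assms(1)] by blast
    from choice[OF this] obtain a where
      a: "\<And>k. (\<lambda>i. poly.coeff (wpoly (v (Suc i))) k) = (\<lambda>i. a k * u i)"
      by blast
    have coeff: "poly.coeff (wpoly (v (Suc i))) k = a k * u i" for k i
      using fun_cong[OF a[of k], of i] .
    have v0: "v 0 = 0" "\<And>i. i \<ge> length rs \<Longrightarrow> v (Suc i) = 0"
      using v relations_rhos_iff[OF assms(1), of v rs] by (auto simp: free_mod_def)
    \<comment> \<open>The inserted 0 keeps \<open>Max\<close> meaningful for empty
      \<open>rs\<close>; the entries beyond \<open>length rs\<close> are 0 and satisfy the
      bound.\<close>
    define N where "N = Max (insert 0 ((\<lambda>i. degree (wpoly (v (Suc i)))) ` {..<length rs}))"
    have deg: "degree (wpoly (v (Suc i))) \<le> N" for i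
      by (cases "i < length rs") (auto simp: N_def v0 wpoly.hom_zero)
    have "v i = (\<Sum>k\<le>N. indet None ^ k * incl (a k)) * lift_rel u i" for i
    proof (cases i)
      case (Suc l)
      have "v i = (\<Sum>k\<le>N. indet None ^ k * incl (a k * u l))"
        using sum_w_powers_eq[OF deg[of l]] by (simp add: coeff Suc)
      then show ?thesis
        by (simp add: Suc lift_rel_simps sum_distrib_right incl.hom_mult mult.assoc)
    qed (simp add: v0 lift_rel_simps)
    then show ?thesis by blast
  qed
  moreover have "(\<lambda>i. a * lift_rel u i) \<in> relations (rhos d rs)" for a
  proof -
    have "(\<lambda>i. 1 * u i) \<in> relations rs"
      unfolding u by blast
    then show ?thesis
      using relations_smult[OF lift_rel_in_relations[OF assms(1)]] by simp
  qed
  ultimately show ?thesis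
    by blast
qed

lemma cyclic_relations_restrict:
  assumes "d \<ge> 2" and u: "relations (rhos d rs) = {(\<lambda>i. a * u i) | a. True}"
  shows "relations rs = {(\<lambda>i. a * poly.coeff (wpoly (u (Suc i))) 0) | a. True}"
proof -
  have "\<exists>a. v = (\<lambda>i. a * poly.coeff (wpoly (u (Suc i))) 0)" if v: "v \<in> relations rs" for v
  proof -
    obtain a where a: "lift_rel v = (\<lambda>i. a * u i)"
      using lift_rel_in_relations[OF assms(1) v] u by blast
    have "v i = poly.coeff (wpoly a) 0 * poly.coeff (wpoly (u (Suc i))) 0" for i
      using arg_cong[OF fun_cong[OF a, of "Suc i"], of "\<lambda>s. poly.coeff (wpoly s) 0"]
      by (simp add: lift_rel_simps wpoly_incl wpoly.hom_mult coeff_mult_0)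
    then show ?thesis by blast
  qed
  moreover have "(\<lambda>i. a * poly.coeff (wpoly (u (Suc i))) 0) \<in> relations rs" for a
  proof -
    have "(\<lambda>i. 1 * u i) \<in> relations (rhos d rs)"
      unfolding u by blast
    then have "(\<lambda>i. poly.coeff (wpoly (u (Suc i))) 0) \<in> relations rs"
      using relations_rhos_iff[OF assms(1), of u rs] by simp
    then show ?thesis by (rule relations_smult)
  qed
  ultimately show ?thesis by blast
qed

lemma minimal_resolutionD:
  assumes "minimal_resolution h ds cs"
  obtains \<delta>s A where "graded_list ds \<delta>s" "minimal_relations \<delta>s" "vmod.span (set \<delta>s) = D0 h"
    "mat_map (length ds) (length cs) A ` free_mod (length cs) = relations \<delta>s"
    "inj_on (mat_map (length ds) (length cs) A) (free_mod (length cs))"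
    "\<And>i j. i < length ds \<Longrightarrow> j < length cs \<Longrightarrow> homogeneous (cs ! j - ds ! i) (A i j)"
    "\<And>i j. i < length ds \<Longrightarrow> j < length cs \<Longrightarrow> const_term (A i j) = 0"
proof -
  obtain \<delta>s A where \<delta>s: "length \<delta>s = length ds"
      "\<forall>i<length ds. \<delta>s ! i \<in> D0 h \<and> homogeneous_der (ds ! i) (\<delta>s ! i)"
    and span: "vmod.span (set \<delta>s) = D0 h"
    and A: "\<forall>i<length ds. \<forall>j<length cs. homogeneous (cs ! j - ds ! i) (A i j)"
      "\<forall>i<length ds. \<forall>j<length cs. const_term (A i j) = 0"
    and im: "mat_map (length ds) (length cs) A ` free_mod (length cs) = relations \<delta>s"
    and inj: "inj_on (mat_map (length ds) (length cs) A) (free_mod (length cs))"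
    using assms unfolding minimal_resolution_def Let_def by blast
  \<comment> \<open>Each relation is a combination of columns of \<open>A\<close>, whose entries
    have no constant term.\<close>
  have "minimal_relations \<delta>s"
    unfolding minimal_relations_def im[symmetric]
    using A(2) by (auto simp: mat_map_def const_term.hom_sum const_term.hom_mult)
  then show thesis
    using \<delta>s A by (intro that[OF _ _ span im inj]) (auto simp: graded_list_def)
qed

lemma minimal_resolutionI:
  assumes "graded_list ds \<delta>s" "vmod.span (set \<delta>s) = D0 h"
    "mat_map (length ds) (length cs) A ` free_mod (length cs) = relations \<delta>s"
    "inj_on (mat_map (length ds) (length cs) A) (free_mod (length cs))"
    "\<And>i j. i < length ds \<Longrightarrow> j < length cs \<Longrightarrow> homogeneous (cs ! j - ds ! i) (A i j)"
    "\<And>i j. i < length ds \<Longrightarrow> j < length cs \<Longrightarrow> const_term (A i j) = 0"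
  shows "minimal_resolution h ds cs"
proof -
  have "set \<delta>s \<subseteq> D0 h"
    using assms(2) vmod.span_superset by blast
  then show ?thesis
    unfolding minimal_resolution_def Let_def
    using assms by (intro exI[of _ \<delta>s] exI[of _ A]) (auto simp: graded_list_def)
qed

lemma minimal_resolution_mset:
  assumes "minimal_resolution h ds cs" "minimal_generators h es rs"
  shows "mset ds = mset es"
proof -
  obtain \<delta>s where "graded_list ds \<delta>s" "minimal_relations \<delta>s" "vmod.span (set \<delta>s) = D0 h"
    by (rule minimal_resolutionD[OF assms(1)]) (rule that)
  then show ?thesis
    using minimal_degrees_unique[of ds \<delta>s es rs] assms(2) by (simp add: minimal_generators_iff)
qed

text \<open>The matrix \<open>A\<close> acquires a zero row for \<open>rho0\<close>; exactness and
  injectivity are then checked separately for each power of \<open>w\<close>.\<close>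

lemma minimal_resolution_cone:
  fixes g :: "('v::{finite,linorder}) mpol"
  assumes d: "d \<ge> 2" and g: "homogeneous (int (d - 1)) g" "g \<noteq> 0" and res: "minimal_resolution g ds cs"
  shows "minimal_resolution (cone_poly g) (1 # ds) cs"
proof -
  let ?p = "length ds" and ?q = "length cs"
  obtain \<delta>s A where \<delta>s: "graded_list ds \<delta>s" "vmod.span (set \<delta>s) = D0 g"
    and im: "mat_map ?p ?q A ` free_mod ?q = relations \<delta>s"
    and inj: "inj_on (mat_map ?p ?q A) (free_mod ?q)"
    and A: "\<And>i j. i < ?p \<Longrightarrow> j < ?q \<Longrightarrow> homogeneous (cs ! j - ds ! i) (A i j)"
      "\<And>i j. i < ?p \<Longrightarrow> j < ?q \<Longrightarrow> const_term (A i j) = 0"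
    by (rule minimal_resolutionD[OF res]) (rule that)
  have len: "length \<delta>s = ?p"
    using \<delta>s(1) by (simp add: graded_list_def)
  define A' where "A' i j = (case i of 0 \<Rightarrow> 0 | Suc l \<Rightarrow> incl (A l j))" for i j
  define cf :: "nat \<Rightarrow> (nat \<Rightarrow> 'v option mpol) \<Rightarrow> nat \<Rightarrow> 'v mpol"
    where "cf k v j = poly.coeff (wpoly (v j)) k" for k v j
  have cf_free: "cf k v \<in> free_mod n" if "v \<in> free_mod n" for k v n
    using that by (simp add: free_mod_def cf_def wpoly.hom_zero)
  have cf_map: "(\<lambda>i. poly.coeff (wpoly (mat_map (Suc ?p) ?q A' v (Suc i))) k) = mat_map ?p ?q A (cf k v)"
    for v k
    by (rule ext)
      (simp add: mat_map_def A'_def cf_def wpoly.hom_zero wpoly.hom_sum coeff_sum coeff_wpoly_incl_mult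
        mult.commute[of "incl _"] mult.commute[of "poly.coeff _ _"])
  have map0: "mat_map (Suc ?p) ?q A' v 0 = 0" for v
    by (simp add: mat_map_def A'_def)
  have map_free: "mat_map (Suc ?p) ?q A' v \<in> free_mod (Suc ?p)" for v
    by (simp add: mat_map_def free_mod_def)
  have "mat_map (Suc ?p) ?q A' v \<in> relations (rhos d \<delta>s)" if v: "v \<in> free_mod ?q" for v
    unfolding relations_rhos_iff[OF d] cf_map len
    using map0 map_free im cf_free[OF v] by blast
  moreover have "u \<in> mat_map (Suc ?p) ?q A' ` free_mod ?q" if "u \<in> relations (rhos d \<delta>s)" for u
  proof -
    have u: "u 0 = 0" "\<And>i. i \<ge> Suc ?p \<Longrightarrow> u i = 0"
        "\<And>k. (\<lambda>i. poly.coeff (wpoly (u (Suc i))) k) \<in> relations \<delta>s"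
      using that relations_rhos_iff[OF d, of u \<delta>s] by (auto simp: free_mod_def len)
    have "\<forall>k. \<exists>v. v \<in> free_mod ?q \<and> (\<lambda>i. poly.coeff (wpoly (u (Suc i))) k) = mat_map ?p ?q A v"
      using u(3) im by blast
    from choice[OF this] obtain V where V: "\<And>k. V k \<in> free_mod ?q"
        "\<And>k. (\<lambda>i. poly.coeff (wpoly (u (Suc i))) k) = mat_map ?p ?q A (V k)"
      by blast
    define N where "N = Max (insert 0 ((\<lambda>i. degree (wpoly (u (Suc i)))) ` {..<?p}))"
    have deg: "degree (wpoly (u (Suc i))) \<le> N" if "i < ?p" for i
      using that by (simp add: N_def)
    define v where "v j = (\<Sum>k\<le>N. indet None ^ k * incl (V k j))" for j
    have "v \<in> free_mod ?q"
      using V(1) by (simp add: free_mod_def v_def incl.hom_zero)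
    moreover have "u i = mat_map (Suc ?p) ?q A' v i" for i
    proof (cases i)
      case (Suc l)
      show ?thesis
      proof (cases "l < ?p")
        case True
        have coeff: "poly.coeff (wpoly (u (Suc l))) k = (\<Sum>j<?q. A l j * V k j)" for k
          using fun_cong[OF V(2)[of k], of l] True by (simp add: mat_map_def)
        have "u i = (\<Sum>k\<le>N. indet None ^ k * incl (\<Sum>j<?q. A l j * V k j))"
          using sum_w_powers_eq[OF deg[OF True]] by (simp add: coeff Suc)
        also have "\<dots> = (\<Sum>k\<le>N. \<Sum>j<?q. incl (A l j) * (indet None ^ k * incl (V k j)))"
          by (simp add: incl.hom_sum incl.hom_mult sum_distrib_left mult.left_commute)
        also have "\<dots> = (\<Sum>j<?q. incl (A l j) * v j)"
          by (subst sum.swap) (simp add: v_def sum_distrib_left)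
        finally show ?thesis
          using True by (simp add: Suc mat_map_def A'_def)
      qed (simp add: u Suc mat_map_def)
    qed (simp add: u map0)
    ultimately show ?thesis
      by (intro image_eqI[of _ _ v]) auto
  qed
  ultimately have im': "mat_map (Suc ?p) ?q A' ` free_mod ?q = relations (rhos d \<delta>s)"
    by blast
  have inj': "inj_on (mat_map (Suc ?p) ?q A') (free_mod ?q)"
  proof (rule inj_onI)
    fix v v'
    assume v: "v \<in> free_mod ?q" "v' \<in> free_mod ?q"
      and eq: "mat_map (Suc ?p) ?q A' v = mat_map (Suc ?p) ?q A' v'"
    have "cf k v = cf k v'" for k
      using inj_onD[OF inj _ cf_free[OF v(1)] cf_free[OF v(2)]] cf_map[of v k] cf_map[of v' k] eq by simp
    then have "wpoly (v j) = wpoly (v' j)" for j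
      by (simp add: poly_eq_iff cf_def fun_eq_iff)
    then show "v = v'"
      by (simp add: wpoly_eq_iff fun_eq_iff)
  qed
  show ?thesis
  proof (rule minimal_resolutionI[OF graded_list_rhos[OF \<delta>s(1)] span_rhos[OF d g \<delta>s(2)]])
    show "mat_map (length (1 # ds)) ?q A' ` free_mod ?q = relations (rhos d \<delta>s)"
      using im' by simp
    show "inj_on (mat_map (length (1 # ds)) ?q A') (free_mod ?q)"
      using inj' by simp
    show "homogeneous (cs ! j - (1 # ds) ! i) (A' i j)" if "i < length (1 # ds)" "j < ?q" for i j
      using that A(1) by (cases i) (simp_all add: A'_def homogeneous_zero homogeneous_incl)
    show "const_term (A' i j) = 0" if "i < length (1 # ds)" "j < ?q" for i j
      using that A(2) by (cases i) (simp_all add: A'_def const_term_incl)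
  qed
qed

text \<open>With a single column, the relations are the multiples of one relation, and injectivity
  of the matrix makes them nontrivial. In this form the resolution can be moved to other minimal
  generators.\<close>

lemma minimal_resolution_cyclicD:
  assumes "minimal_resolution h ds [c]"
  obtains \<delta>s u where "graded_list ds \<delta>s" "minimal_relations \<delta>s" "vmod.span (set \<delta>s) = D0 h"
    "relations \<delta>s = {(\<lambda>i. a * u i) | a. True}" "relations \<delta>s \<noteq> {\<lambda>_. 0}"
    "\<And>i. i < length \<delta>s \<Longrightarrow> homogeneous (c - ds ! i) (u i)"
proof -
  obtain \<delta>s A where \<delta>s: "graded_list ds \<delta>s" "minimal_relations \<delta>s" "vmod.span (set \<delta>s) = D0 h"
    and im: "mat_map (length ds) 1 A ` free_mod 1 = relations \<delta>s"
    and inj: "inj_on (mat_map (length ds) 1 A) (free_mod 1)"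
    and A: "\<And>i. i < length ds \<Longrightarrow> homogeneous (c - ds ! i) (A i 0)"
    by (rule minimal_resolutionD[OF assms]) (rule that, auto)
  define u where "u i = (if i < length ds then A i 0 else 0)" for i
  define e where "e a = (\<lambda>j::nat. if j = 0 then a else 0 :: 'a mpol)" for a
  have map: "mat_map (length ds) 1 A v = (\<lambda>i. v 0 * u i)" for v
    by (auto simp: mat_map_def u_def mult.commute)
  have e: "e a \<in> free_mod 1" "e a 0 = a" for a
    by (simp_all add: free_mod_def e_def)
  show thesis
  proof (rule that[OF \<delta>s])
    show "relations \<delta>s = {(\<lambda>i. a * u i) | a. True}"
      unfolding im[symmetric] map using e by (auto simp: image_iff) (metis e)
    show "relations \<delta>s \<noteq> {\<lambda>_. 0}"
    proof
      assume "relations \<delta>s = {\<lambda>_. 0}"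
      then have "mat_map (length ds) 1 A (e a) = (\<lambda>_. 0)" for a
        using im e(1)[of a] by blast
      then have "mat_map (length ds) 1 A (e 1) = mat_map (length ds) 1 A (e 0)"
        by simp
      then have "e 1 = (e 0 :: nat \<Rightarrow> 'a mpol)"
        using inj_onD[OF inj _ e(1) e(1)] by blast
      then show False
        using e(2)[of 1] e(2)[of 0] by simp
    qed
    show "homogeneous (c - ds ! i) (u i)" if "i < length \<delta>s" for i
      using A that \<delta>s(1) by (simp add: u_def graded_list_def)
  qed
qed

text \<open>The way back: over an integral domain, \<open>a\<close> is determined by the multiple
  \<open>a\<close> of a nonzero relation, which gives injectivity.\<close>

lemma minimal_resolution_cyclicI:
  fixes \<delta>s :: "('v::{finite,linorder}) derivation list"
  assumes \<delta>s: "graded_list ds \<delta>s" "minimal_relations \<delta>s" "vmod.span (set \<delta>s) = D0 h"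
    and u: "relations \<delta>s = {(\<lambda>i. a * u i) | a. True}" "relations \<delta>s \<noteq> {\<lambda>_. 0}"
    and deg: "\<And>i. i < length \<delta>s \<Longrightarrow> homogeneous (c - ds ! i) (u i)"
  shows "minimal_resolution h ds [c]"
proof -
  have len: "length ds = length \<delta>s"
    using \<delta>s(1) by (simp add: graded_list_def)
  have "(\<lambda>i. 1 * u i) \<in> relations \<delta>s"
    unfolding u(1) by blast
  then have urel: "u \<in> relations \<delta>s"
    by simp
  then have u0: "u i = 0" if "\<not> i < length ds" for i
    using that by (simp add: relations_def free_mod_def len)
  have map: "mat_map (length ds) 1 (\<lambda>i j. u i) v = (\<lambda>i. v 0 * u i)" for v
    by (auto simp: mat_map_def mult.commute u0)
  have "u \<noteq> (\<lambda>_. 0)"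
    using u by auto
  then obtain i where i: "u i \<noteq> 0"
    by auto
  have e: "(\<lambda>j. if j = 0 then a else 0) \<in> free_mod 1" for a :: "'v mpol"
    by (simp add: free_mod_def)
  show ?thesis
  proof (rule minimal_resolutionI[OF \<delta>s(1,3), where A = "\<lambda>i j. u i"])
    have "\<exists>v\<in>free_mod 1. (\<lambda>i. a * u i) = (\<lambda>i. v 0 * u i)" for a
      using e[of a] by (intro bexI) auto
    then show "mat_map (length ds) (length [c]) (\<lambda>i j. u i) ` free_mod (length [c]) = relations \<delta>s"
      unfolding u(1) by (auto simp: map[simplified] image_iff)
    show "inj_on (mat_map (length ds) (length [c]) (\<lambda>i j. u i)) (free_mod (length [c]))"
    proof (rule inj_onI)
      fix v v' :: "nat \<Rightarrow> 'v mpol"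
      assume v: "v \<in> free_mod (length [c])" "v' \<in> free_mod (length [c])"
        and eq: "mat_map (length ds) (length [c]) (\<lambda>i j. u i) v = mat_map (length ds) (length [c]) (\<lambda>i j. u i) v'"
      have "v 0 * u i = v' 0 * u i"
        using fun_cong[OF eq, of i] by (simp add: map[simplified])
      then have "v 0 = v' 0"
        using i by simp
      then have "v j = v' j" for j
        using v by (cases j) (simp_all add: free_mod_def)
      then show "v = v'" by blast
    qed
  qed (use deg \<delta>s(2) urel in \<open>simp_all add: len minimal_relations_def\<close>)
qed

section \<open>Tameness, freeness and plus-one generation\<close>

text \<open>Since the degrees are sorted, \<open>rs ! 0\<close> has least degree among all nonzero
  homogeneous syzygies, as \<open>minimal_syzygy_primitive\<close> requires.\<close>

lemma parallel_minimal_generator: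
  fixes g :: "3 mpol"
  assumes g: "homogeneous n g" and mdr: "mdr g > 0" and gens: "minimal_generators g es rs"
    and rs: "rs \<noteq> []" and parallel: "\<And>i j. v $ i * rs ! 0 $ j = v $ j * rs ! 0 $ i"
  obtains b where "v = b *s rs ! 0"
proof -
  have len: "0 < length es" "length es = length rs" and "sorted es"
    using gens rs by (auto simp: minimal_generators_def)
  then have first: "es ! 0 \<le> e" if "e \<in> set es" for e
    using that by (cases es) auto
  have "1 \<le> es ! 0"
    using minimal_generators_degree_ge_1[OF mdr gens] len by simp
  then have e: "int (nat (es ! 0)) = es ! 0"
    by simp
  show thesis
  proof (rule minimal_syzygy_primitive[OF g, of "rs ! 0" "nat (es ! 0)" v])
    show "rs ! 0 \<in> D0 g" "rs ! 0 \<noteq> 0" "homogeneous_der (int (nat (es ! 0))) (rs ! 0)"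
      unfolding e using gens rs minimal_generators_nonzero[OF gens, of 0]
      by (simp_all add: minimal_generators_def)
    show "int (nat (es ! 0)) \<le> k" if "\<beta> \<in> D0 g" "\<beta> \<noteq> 0" "homogeneous_der k \<beta>" for k \<beta>
      unfolding e using degree_ge[OF gens first that] .
  qed (use parallel that in auto)
qed

text \<open>If the Koszul syzygies vanish, so do all partial derivatives of \<open>g\<close>, and
  Euler's formula gives \<open>g = 0\<close>. This ensures that there is a generator r_1 at
  all.\<close>

lemma D0_nonzero:
  fixes g :: "3 mpol"
  assumes "homogeneous (int n) g" "n > 0" "g \<noteq> 0"
  shows "D0 g \<noteq> {0}"
proof
  assume D0: "D0 g = {0}"
  have "partial_deriv j g = 0" for j
  proof -
    obtain k where k: "k \<noteq> j"
      by (metis zero_neq_one)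
    define \<alpha> :: "3 derivation" where
      "\<alpha> = (\<chi> i. if i = k then partial_deriv j g else if i = j then - partial_deriv k g else 0)"
    have "\<alpha> $ i * partial_deriv i g = (if i = k then partial_deriv j g * partial_deriv k g else 0)
        + (if i = j then - (partial_deriv j g * partial_deriv k g) else 0)" for i
      using k by (auto simp: \<alpha>_def)
    then have "\<alpha> \<in> D0 g"
      by (simp add: D0_def sum.distrib)
    then have "\<alpha> $ k = 0"
      using D0 by simp
    then show ?thesis
      by (simp add: \<alpha>_def)
  qed
  then have "of_nat n * g = 0"
    using euler_formula[OF assms(1)] by simp
  then show False
    using assms(2,3) by simp
qed

lemma Fract_eq_0_iff: "Fract a 1 = 0 \<longleftrightarrow> a = 0"
  by (metis Zero_fract_def eq_fract(1) mult.right_neutral mult_zero_left zero_neq_one)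

text \<open>The minor in the coordinates \<open>None\<close>, \<open>Some i\<close>,
  \<open>Some j\<close> of \<open>b *s rho0 d + \<tau>\<close>, \<open>rho0 d\<close> and a lifted
  derivation, with \<open>n\<close> the \<open>w\<close>-coordinate of \<open>rho0 d\<close>.
  Subtracting \<open>b\<close> times the second row leaves one 2 by 2 minor.\<close>

lemma det_tame:
  fixes b :: "'a::comm_ring_1"
  shows "det (vector [vector [b * n, b * x + s, b * y + t], vector [n, x, y], vector [0, p, q]] :: 'a ^ 3 ^ 3)
    = (t * p - s * q) * n"
  by (simp add: det_3 algebra_simps)

lemma tame_cone:
  fixes g :: "3 mpol"
  assumes d: "d \<ge> 2" and g: "homogeneous (int (d - 1)) g" "g \<noteq> 0" and mdr: "mdr g > 0"
    and gens: "minimal_generators g es rs"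
  shows "tame (cone_poly g) (rhos d rs ! 0) (rhos d rs ! 1)"
proof -
  have "rs \<noteq> []"
    using D0_nonzero[OF g(1) _ g(2)] d gens by (auto simp: minimal_generators_def)
  define r where "r = rs ! 0"
  have r: "r \<in> D0 g" "r \<noteq> 0"
    using gens \<open>rs \<noteq> []\<close> minimal_generators_nonzero[OF gens, of 0]
    by (simp_all add: r_def minimal_generators_def)
  have rhos: "rhos d rs ! 0 = rho0 d" "rhos d rs ! 1 = lift_der r"
    using \<open>rs \<noteq> []\<close> by (simp_all add: rhos_def r_def)
  have nz: "rho0 d $ None \<noteq> (0 :: 3 option mpol)"
    using smult_rho0_None_eq_0_iff[OF d, of "1 :: 3 option mpol"] by simp
  have indep: "frac_independent (rho0 d) (lift_der r)"
    unfolding frac_independent_def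
  proof (intro allI impI)
    fix a b :: "3 option mpol fract"
    assume eq: "\<forall>i. a * Fract (rho0 d $ i) 1 + b * Fract (lift_der r $ i) 1 = 0"
    have "a * Fract (rho0 d $ None) 1 = 0"
      using eq[rule_format, of None] Fract_eq_0_iff[of "0 :: 3 option mpol"] by (simp add: lift_der_nth)
    then have a: "a = 0"
      using nz by (simp add: Fract_eq_0_iff)
    obtain i where "r $ i \<noteq> 0"
      using r by (auto simp: vec_eq_iff)
    then have "b = 0"
      using eq[rule_format, of "Some i"] a by (simp add: lift_der_nth Fract_eq_0_iff incl_eq_0_iff)
    with a show "a = 0 \<and> b = 0" by simp
  qed
  have "\<exists>a b. \<delta> = a *s rho0 d + b *s lift_der r"
    if \<delta>: "\<delta> \<in> D0 (cone_poly g)" and wedge: "wedge_vanishes \<delta> (rho0 d) (lift_der r)" for \<delta>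
  proof -
    obtain b where b: "(\<delta> - b *s rho0 d) $ None = 0"
      using D0_cone_subtract_rho0[OF d g(2) \<delta>] by blast
    define \<tau> where "\<tau> = \<delta> - b *s rho0 d"
    have \<tau>0: "\<tau> $ None = 0"
      using b by (simp add: \<tau>_def)
    have \<delta>_nth: "\<delta> $ i = b * rho0 d $ i + \<tau> $ i" for i
      by (simp add: \<tau>_def)
    \<comment> \<open>Minors through the \<open>w\<close>-coordinate turn the wedge condition into
      parallelism of \<open>\<tau>\<close> with the lift of \<open>r\<close>.\<close>
    have cross: "\<tau> $ Some i * incl (r $ j) = \<tau> $ Some j * incl (r $ i)" for i j
    proof -
      have "det (vector [vector [\<delta> $ None, \<delta> $ Some i, \<delta> $ Some j],
          vector [rho0 d $ None, rho0 d $ Some i, rho0 d $ Some j],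
          vector [lift_der r $ None, lift_der r $ Some i, lift_der r $ Some j]] :: 3 option mpol ^ 3 ^ 3) = 0"
        using wedge unfolding wedge_vanishes_def by blast
      then have "(\<tau> $ Some j * incl (r $ i) - \<tau> $ Some i * incl (r $ j)) * rho0 d $ None = 0"
        by (simp only: \<delta>_nth \<tau>0 lift_der_nth add_0_right det_tame)
      then show ?thesis
        using nz by simp
    qed
    \<comment> \<open>The entries of \<open>r\<close> do not involve \<open>w\<close>, so every
      slice is parallel to \<open>r\<close> and hence a multiple of it.\<close>
    have "\<exists>c. slice k \<tau> = c *s r" for k
    proof -
      have "slice k \<tau> $ i * r $ j = slice k \<tau> $ j * r $ i" for i j
        using arg_cong[OF cross[of i j], of "\<lambda>s. poly.coeff (wpoly s) k"]
        by (simp add: coeff_wpoly_incl_mult slice_def)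
      then show ?thesis
        using parallel_minimal_generator[OF g(1) mdr gens \<open>rs \<noteq> []\<close>, of "slice k \<tau>"] unfolding r_def by blast
    qed
    then obtain c where c: "\<And>k. slice k \<tau> = c k *s r"
      by metis
    obtain N where "\<tau> = (\<Sum>k<N. indet None ^ k *s lift_der (slice k \<tau>))"
      using sum_lift_slices[OF \<tau>0] by blast
    also have "\<dots> = (\<Sum>k<N. (indet None ^ k * incl (c k)) *s lift_der r)"
      by (rule sum.cong) (simp_all add: c vec_eq_iff split_option_all lift_der_nth incl.hom_mult mult.assoc)
    also have "\<dots> = (\<Sum>k<N. indet None ^ k * incl (c k)) *s lift_der r"
      by (rule vmod.scale_sum_left[symmetric])
    finally have "\<delta> = b *s rho0 d + (\<Sum>k<N. indet None ^ k * incl (c k)) *s lift_der r"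
      by (simp add: \<tau>_def algebra_simps)
    then show ?thesis by blast
  qed
  then show ?thesis
    unfolding tame_def rhos using rho0_in_D0[OF g(1)] lift_der_in_D0[OF r(1)] indep by blast
qed

text \<open>A nontrivial relation between the first two generators would make them parallel, hence
  the second a multiple of the first, against minimality. This is the source of strictness for the
  cone.\<close>

lemma relations_first_two_trivial:
  fixes g :: "3 mpol"
  assumes g: "homogeneous n g" and mdr: "mdr g > 0" and gens: "minimal_generators g es rs"
    and len: "length rs = 3" and u: "u \<in> relations rs" "u 2 = 0"
  shows "u = (\<lambda>_. 0)"
proof -
  have eq: "u 0 *s rs ! 0 + u 1 *s rs ! 1 = 0"
    using u len by (simp add: relations_def numeral_3_eq_3 numeral_2_eq_2)
  have nz: "rs ! 0 \<noteq> 0"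
    using minimal_generators_nonzero[OF gens, of 0] len by simp
  have u1: "u 1 = 0"
  proof (rule ccontr)
    assume u1: "u 1 \<noteq> 0"
    have nth: "u 1 * rs ! 1 $ i = - (u 0 * rs ! 0 $ i)" for i
      using arg_cong[OF eq, of "\<lambda>\<alpha>. \<alpha> $ i"] by (simp add: eq_neg_iff_add_eq_0 add.commute)
    have "u 1 * (rs ! 1 $ i * rs ! 0 $ j) = u 1 * (rs ! 1 $ j * rs ! 0 $ i)" for i j
      using nth[of i] nth[of j] by (simp add: mult.assoc[symmetric])
    then have "rs ! 1 $ i * rs ! 0 $ j = rs ! 1 $ j * rs ! 0 $ i" for i j
      using u1 by simp
    moreover have "rs \<noteq> []"
      using len by auto
    ultimately obtain b where "rs ! 1 = b *s rs ! 0"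
      using parallel_minimal_generator[OF g mdr gens, of "rs ! 1"] by blast
    moreover have "rs ! 0 \<in> {rs ! j | j. j < length rs \<and> j \<noteq> 1}"
      using len by force
    then have "b *s rs ! 0 \<in> vmod.span {rs ! j | j. j < length rs \<and> j \<noteq> 1}"
      by (intro vmod.span_scale vmod.span_base)
    ultimately have "rs ! 1 \<in> vmod.span {rs ! j | j. j < length rs \<and> j \<noteq> 1}"
      by simp
    then show False
      using gens len by (simp add: minimal_generators_def)
  qed
  have "u 0 = 0"
  proof -
    obtain i where "rs ! 0 $ i \<noteq> 0"
      using nz by (auto simp: vec_eq_iff)
    then show ?thesis
      using arg_cong[OF eq, of "\<lambda>\<alpha>. \<alpha> $ i"] u1 by simp
  qed
  moreover have "u i = 0" if "i \<ge> 3" for i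
    using u(1) that len by (simp add: relations_def free_mod_def)
  moreover have "i = 0 \<or> i = 1 \<or> i = 2 \<or> i \<ge> 3" for i :: nat
    by linarith
  ultimately show ?thesis
    using u1 u(2) by metis
qed

lemma free_cone_iff:
  fixes g :: "('v::{finite,linorder}) mpol"
  assumes "d \<ge> 2" "homogeneous (int (d - 1)) g" "g \<noteq> 0" "mdr g > 0" "minimal_generators g es rs"
  shows "free_hypersurface (cone_poly g) \<longleftrightarrow> free_hypersurface g"
  by (simp add: free_hypersurface_iff[OF minimal_generators_rhos[OF assms]]
      free_hypersurface_iff[OF assms(5)] relations_rhos_trivial_iff[OF assms(1)])

lemma nearly_free_cone_iff:
  fixes g :: "3 mpol"
  assumes "d \<ge> 2" "homogeneous (int (d - 1)) g" "g \<noteq> 0" "mdr g > 0" "minimal_generators g es rs"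
  shows "nearly_free (cone_poly g) \<longleftrightarrow> nearly_free g"
proof
  assume "nearly_free g"
  then obtain es' where es': "length es' = 2" "sorted es'" "minimal_resolution g (es' @ [last es']) [last es' + 1]"
    by (auto simp: nearly_free_def)
  have "mset (es' @ [last es']) = mset es"
    using minimal_resolution_mset[OF es'(3) assms(5)] .
  then have "set es' \<subseteq> set es"
    by (metis Un_upper1 set_append set_mset_mset)
  \<comment> \<open>Degree 1 can head the list because no generator of \<open>D0 g\<close> has
    smaller degree; the repeated last degree stays the same.\<close>
  then have "sorted (1 # es')"
    using es'(2) minimal_generators_degree_ge_1[OF assms(4,5)] by auto
  moreover have "last (1 # es') = last es'"
    using es'(1) by auto
  ultimately show "nearly_free (cone_poly g)"
    using es'(1) minimal_resolution_cone[OF assms(1-3) es'(3)]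
    unfolding nearly_free_def by (intro exI[of _ "1 # es'"]) simp
next
  note gens' = minimal_generators_rhos[OF assms]
  assume "nearly_free (cone_poly g)"
  then obtain es' where es': "length es' = 3" "sorted es'"
    "minimal_resolution (cone_poly g) (es' @ [last es']) [last es' + 1]"
    by (auto simp: nearly_free_def)
  obtain x y z where xyz: "es' = [x, y, z]"
    using es'(1) by (auto simp: length_Suc_conv numeral_3_eq_3)
  \<comment> \<open>Both lists are sorted and agree as multisets, so \<open>x\<close> is the degree
    1 of \<open>rho0\<close> and \<open>rs\<close> has degrees \<open>y\<close>, \<open>z\<close>,
    \<open>z\<close>.\<close>
  have "mset [x, y, z, z] = mset (1 # es)"
    using minimal_resolution_mset[OF es'(3) gens'] by (simp add: xyz)
  moreover have "sorted [x, y, z, z]" "sorted (1 # es)"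
    using es'(2) gens' by (simp_all add: xyz minimal_generators_def)
  ultimately have "[x, y, z, z] = 1 # es"
    by (metis properties_for_sort)
  then have es: "es = [y, z, z]"
    by simp
  have res: "minimal_resolution (cone_poly g) [x, y, z, z] [z + 1]"
    using es'(3) by (simp add: xyz)
  obtain \<delta>s u where \<delta>s: "graded_list [x, y, z, z] \<delta>s" "minimal_relations \<delta>s"
      "vmod.span (set \<delta>s) = D0 (cone_poly g)"
    and u: "relations \<delta>s = {(\<lambda>i. a * u i) | a. True}" "relations \<delta>s \<noteq> {\<lambda>_. 0}"
      "\<And>i. i < length \<delta>s \<Longrightarrow> homogeneous (z + 1 - [x, y, z, z] ! i) (u i)"
    by (rule minimal_resolution_cyclicD[OF res]) (rule that)
  have rhos: "graded_list (1 # es) (rhos d rs)" "minimal_relations (rhos d rs)"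
      "vmod.span (set \<delta>s) = vmod.span (set (rhos d rs))"
    using minimal_generatorsD[OF gens'] \<delta>s(3) by simp_all
  obtain v where v: "relations (rhos d rs) = {(\<lambda>i. a * v i) | a. True}"
      "\<And>i. i < length (rhos d rs) \<Longrightarrow> homogeneous (z + 1 - (1 # es) ! i) (v i)"
    by (rule cyclic_relations_transfer[OF \<delta>s(1) rhos u(1,3)]) (assumption, rule that)
  \<comment> \<open>Trivial relations would transfer back from \<open>rhos d rs\<close> to
    \<open>\<delta>s\<close>.\<close>
  have nontrivial: "relations (rhos d rs) \<noteq> {\<lambda>_. 0}"
  proof
    assume triv: "relations (rhos d rs) = {\<lambda>_. 0}"
    then have triv': "relations (rhos d rs) = {(\<lambda>i. a * (\<lambda>_. 0) i) | a. True}"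
      by simp
    have "relations \<delta>s = {\<lambda>_. 0}"
    proof (rule cyclic_relations_transfer[OF rhos(1) \<delta>s(1,2) rhos(3)[symmetric] triv', where c = 0])
      fix w
      assume "relations \<delta>s = {(\<lambda>i. a * w i) | a. True}" "\<And>i. (\<lambda>_. 0) = (\<lambda>_. 0) \<Longrightarrow> w i = 0"
      then show ?thesis by simp
    qed (rule homogeneous_zero)
    with u(2) show False by simp
  qed
  have deg: "homogeneous (z + 1 - es ! i) (poly.coeff (wpoly (v (Suc i))) 0)" if "i < length rs" for i
    using v(2)[of "Suc i"] that by (intro homogeneous_coeff_wpoly_0) (simp add: rhos_def)
  have "minimal_resolution g es [z + 1]"
    using minimal_resolution_cyclicI[OF minimal_generatorsD[OF assms(5)]
        cyclic_relations_restrict[OF assms(1) v(1)] _ deg]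
      nontrivial relations_rhos_trivial_iff[OF assms(1), of rs] by simp
  then show "nearly_free g"
    using es'(2) unfolding nearly_free_def by (intro exI[of _ "[y, z]"]) (simp add: es xyz)
qed

lemma plus_one_cone_iff:
  fixes g :: "3 mpol"
  assumes "d \<ge> 2" "homogeneous (int (d - 1)) g" "g \<noteq> 0" "mdr g > 0" "minimal_generators g es rs"
  shows "strictly_plus_one_generated (cone_poly g) (take 4 (rhos d rs)) \<longleftrightarrow>
    plus_one_generated g (take 3 rs)"
proof
  assume "strictly_plus_one_generated (cone_poly g) (take 4 (rhos d rs))"
  then obtain es' u where rel: "plus_one_relation (cone_poly g) es' (take 4 (rhos d rs)) u"
    by (auto simp: strictly_plus_one_generated_def)
  then have gens': "minimal_generators (cone_poly g) es' (take 4 (rhos d rs))"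
    and len: "length (take 4 (rhos d rs)) = 4"
    by (simp_all add: plus_one_relation_def)
  \<comment> \<open>Minimal systems have the same degrees, so \<open>take 4\<close> discards nothing
    and \<open>rs\<close> has exactly three entries.\<close>
  have es': "es' = 1 # es"
    using minimal_generators_degrees_unique[OF gens' minimal_generators_rhos[OF assms]] .
  then have "length es = 3" "length rs = 3"
    using gens' len assms(5) by (simp_all add: minimal_generators_def)
  then have take: "take 4 (rhos d rs) = rhos d rs" "take 3 rs = rs" and last: "last es' = last es"
    by (auto simp: rhos_def es')
  have cyc: "relations (rhos d rs) = {(\<lambda>i. a * u i) | a. True}"
    and deg: "\<And>i. i < 4 \<Longrightarrow> homogeneous (last es' + 1 - es' ! i) (u i)"
    using rel len by (simp_all add: plus_one_relation_def take)
  have free: "\<And>a. (\<forall>i. a * u i = 0) \<Longrightarrow> a = 0"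
    using rel unfolding plus_one_relation_def by blast
  define v where "v i = poly.coeff (wpoly (u (Suc i))) 0" for i
  have cyc': "relations rs = {(\<lambda>i. a * v i) | a. True}"
    unfolding v_def by (rule cyclic_relations_restrict[OF assms(1) cyc])
  \<comment> \<open>If the relation vanished at \<open>w = 0\<close>, the curve and hence the cone
    would have only trivial relations, but \<open>u\<close> is a nonzero one.\<close>
  have "v \<noteq> (\<lambda>_. 0)"
  proof
    assume "v = (\<lambda>_. 0)"
    then have "relations (rhos d rs) = {\<lambda>_. 0}"
      using cyc' relations_rhos_trivial_iff[OF assms(1), of rs] by simp
    moreover have "(\<lambda>i. 1 * u i) \<in> relations (rhos d rs)"
      unfolding cyc by blast
    ultimately have "\<forall>i. 1 * u i = 0"
      by (simp add: fun_eq_iff)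
    then show False
      using free[of 1] by simp
  qed
  then obtain i where "v i \<noteq> 0"
    by auto
  have "homogeneous (last es + 1 - es ! i) (v i)" if "i < 3" for i
    unfolding v_def using deg[of "Suc i"] that
    by (intro homogeneous_coeff_wpoly_0) (simp add: last[symmetric], simp add: es')
  then have "plus_one_relation g es rs v"
    using assms(5) cyc' \<open>length rs = 3\<close> \<open>v i \<noteq> 0\<close>
    by (auto simp: plus_one_relation_def)
  then show "plus_one_generated g (take 3 rs)"
    by (auto simp: plus_one_generated_def take)
next
  assume "plus_one_generated g (take 3 rs)"
  then obtain es' u where rel: "plus_one_relation g es' (take 3 rs) u"
    by (auto simp: plus_one_generated_def)
  \<comment> \<open>In this direction the first three generators are by hypothesis a minimal system
    themselves, and they replace \<open>rs\<close> from here on.\<close>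
  define rs' where "rs' = take 3 rs"
  have gens': "minimal_generators g es' rs'" and len: "length rs' = 3"
    and cyc: "relations rs' = {(\<lambda>i. a * u i) | a. True}"
    and deg: "\<And>i. i < 3 \<Longrightarrow> homogeneous (last es' + 1 - es' ! i) (u i)"
    using rel by (simp_all add: plus_one_relation_def flip: rs'_def)
  have free: "\<And>a. (\<forall>i. a * u i = 0) \<Longrightarrow> a = 0"
    using rel unfolding plus_one_relation_def by blast
  have take: "take 4 (rhos d rs) = rhos d rs'"
    by (simp add: rhos_def rs'_def take_map)
  have "length es' = 3"
    using gens' len by (simp add: minimal_generators_def)
  then have last: "last (1 # es') = last es'"
    by auto
  have "(\<lambda>i. 1 * u i) \<in> relations rs'"
    unfolding cyc by blast
  then have "u \<in> relations rs'"
    by simp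
  moreover have "u \<noteq> (\<lambda>_. 0)"
    using free[of 1] by auto
  \<comment> \<open>Counting from 0, this is the coefficient of the third generator; it moves to
    position 3 once \<open>rho0\<close> is put in front.\<close>
  ultimately have u2: "u 2 \<noteq> 0"
    using relations_first_two_trivial[OF assms(2,4) gens' len] by blast
  have lift2: "lift_rel u 3 \<noteq> 0"
    using u2 lift_rel_simps(2)[of u 2] by (simp add: incl_eq_0_iff)
  have "homogeneous (last (1 # es') + 1 - (1 # es') ! i) (lift_rel u i)" if "i < 4" for i
    using deg that unfolding last
    by (cases i) (simp_all add: lift_rel_simps homogeneous_zero homogeneous_incl)
  then have "plus_one_relation (cone_poly g) (1 # es') (rhos d rs') (lift_rel u)"
    using minimal_generators_rhos[OF assms(1-4) gens'] cyclic_relations_lift[OF assms(1) cyc] lift2 len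
    by (auto simp: plus_one_relation_def rhos_def)
  then show "strictly_plus_one_generated (cone_poly g) (take 4 (rhos d rs))"
    using lift2 len unfolding take strictly_plus_one_generated_def
    by (intro exI[of _ "1 # es'"] exI[of _ "lift_rel u"]) (simp add: rhos_def)
qed

theorem theorem1p6:
  fixes g :: "3 mpol" and d :: nat and es :: "int list" and rs :: "3 derivation list"
  assumes "d \<ge> 3"
    and "homogeneous (int (d - 1)) g" and "squarefree g"
    and "mdr g > 0"
    and "minimal_generators g es rs"
  shows "(minimal_generators (cone_poly g) (1 # es) (rhos d rs) \<and>
          mdr (cone_poly g) = 1 \<and>
          (\<forall>ds cs. minimal_resolution g ds cs \<longrightarrow>
             length ds = length rs \<and> minimal_resolution (cone_poly g) (1 # ds) cs)) \<and>
         tame (cone_poly g) (rhos d rs ! 0) (rhos d rs ! 1) \<and>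
         (free_hypersurface (cone_poly g) \<longleftrightarrow> free_hypersurface g) \<and>
         (nearly_free (cone_poly g) \<longleftrightarrow> nearly_free g) \<and>
         (strictly_plus_one_generated (cone_poly g) (take 4 (rhos d rs)) \<longleftrightarrow>
            plus_one_generated g (take 3 rs))"
proof -
  have d: "d \<ge> 2"
    using assms(1) by simp
  \<comment> \<open>Zero is divisible by the square of a non-unit, so it is not squarefree.\<close>
  have g: "g \<noteq> 0"
    using assms(3) by auto
  have "length ds = length rs" if "minimal_resolution g ds cs" for ds cs
    using minimal_resolution_mset[OF that assms(5)] assms(5) mset_eq_length
    by (metis minimal_generators_def)
  then show ?thesis
    using minimal_generators_rhos[OF d assms(2) g assms(4,5)] mdr_cone_poly[OF d assms(2) g assms(4,5)]
      minimal_resolution_cone[OF d assms(2) g] tame_cone[OF d assms(2) g assms(4,5)]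
      free_cone_iff[OF d assms(2) g assms(4,5)] nearly_free_cone_iff[OF d assms(2) g assms(4,5)]
      plus_one_cone_iff[OF d assms(2) g assms(4,5)]
    by blast
qed

end
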